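(* For $N=1,2,3,4,6,12$ the ideal of cusp forms $\mathcal S(\Gamma(N))_{\mathbb M}$ of the graded ring $\mathcal M(\Gamma(N))_{\mathbb M}$ is a principal ideal, namely $$\mathcal S(\Gamma(N))_{\mathbb M}=\mathcal M(\Gamma(N))_{\mathbb M}\,\eta^{24/N}.$$
   Context: $\Gamma(N)\subset \mathrm{SL}_2(\mathbb Z)$ is the principal congruence subgroup of level $N$; $\mathbb M=\{0,1,2,\dots\}$. $\mathcal M(\Gamma(N))_k$ is the $\mathbb C$-vector space of (holomorphic) modular forms of weight $k$ for $\Gamma(N)$ and $\mathcal S(\Gamma(N))_k$ its subspace of cusp forms; $\mathcal M(\Gamma(N))_{\mathbb M}=\bigoplus_{k\in\mathbb M}\mathcal M(\Gamma(N))_k$ and $\mathcal S(\Gamma(N))_{\mathbb M}=\bigoplus_{k\in\mathbb M}\mathcal S(\Gamma(N))_k$. $\eta(\tau)=q^{1/24}\prod_{n\ge1}(1-q^n)$ with $q^r=e^{2\pi i r\tau}$ is the Dedekind eta function. *)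

theory Defs
  imports
    "HOL-Complex_Analysis.Complex_Analysis"
    "HOL-Algebra.Ideal"
    "HOL-Number_Theory.Cong"
begin

unbundle no fps_syntax

definition upper_half_plane :: "complex set" where
  "upper_half_plane = {\<tau>. Im \<tau> > 0}"

definition SL2Z :: "(int ^ 2 ^ 2) set" where
  "SL2Z = {A. det A = 1}"

definition principal_congruence_subgroup :: "nat \<Rightarrow> (int ^ 2 ^ 2) set" where
  "principal_congruence_subgroup N =
     {A \<in> SL2Z. \<forall>i j. [A $ i $ j = mat 1 $ i $ j] (mod int N)}"

definition moebius :: "int ^ 2 ^ 2 \<Rightarrow> complex \<Rightarrow> complex" where
  "moebius A \<tau> =
     (of_int (A $ 1 $ 1) * \<tau> + of_int (A $ 1 $ 2)) / (of_int (A $ 2 $ 1) * \<tau> + of_int (A $ 2 $ 2))"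

definition slash :: "nat \<Rightarrow> (complex \<Rightarrow> complex) \<Rightarrow> int ^ 2 ^ 2 \<Rightarrow> complex \<Rightarrow> complex" where
  "slash k f A \<tau> = f (moebius A \<tau>) / (of_int (A $ 2 $ 1) * \<tau> + of_int (A $ 2 $ 2)) ^ k"

text \<open>
  A Fourier expansion in nonnegative powers of \<open>q\<^sup>1\<^sup>/\<^sup>N\<close>. As the principal congruence subgroup of
  level \<open>N\<close> is normal and contains the translation \<open>\<tau> \<mapsto> \<tau> + N\<close>, this is the right local parameter
  at every cusp.
\<close>

definition has_q_expansion :: "nat \<Rightarrow> (complex \<Rightarrow> complex) \<Rightarrow> (nat \<Rightarrow> complex) \<Rightarrow> bool" where
  "has_q_expansion N g a \<longleftrightarrow>
     (\<forall>\<tau>\<in>upper_half_plane.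
        (\<lambda>n. a n * exp (2 * of_real pi * \<i> * of_nat n * \<tau> / of_nat N)) sums g \<tau>)"

text \<open>
  Functions on the upper half-plane are represented by functions on \<open>\<complex>\<close> that are \<open>0\<close> elsewhere, so
  that equality of functions is equality on the upper half-plane. The expansions of all \<open>f |\<^sub>k A\<close>
  with \<open>A\<close> in the full modular group account for all cusps.
\<close>

definition modular_forms :: "nat \<Rightarrow> nat \<Rightarrow> (complex \<Rightarrow> complex) set" where
  "modular_forms N k =
     {f. f holomorphic_on upper_half_plane \<and>
         (\<forall>\<tau>. \<tau> \<notin> upper_half_plane \<longrightarrow> f \<tau> = 0) \<and>
         (\<forall>A\<in>principal_congruence_subgroup N. \<forall>\<tau>\<in>upper_half_plane. slash k f A \<tau> = f \<tau>) \<and>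
         (\<forall>A\<in>SL2Z. \<exists>a. has_q_expansion N (slash k f A) a)}"

definition cusp_forms :: "nat \<Rightarrow> nat \<Rightarrow> (complex \<Rightarrow> complex) set" where
  "cusp_forms N k =
     {f \<in> modular_forms N k. \<forall>A\<in>SL2Z. \<exists>a. has_q_expansion N (slash k f A) a \<and> a 0 = 0}"

text \<open>
  Elements of a direct sum over all weights are families of finite support; \<open>F k\<close> is the component
  of weight \<open>k\<close>.
\<close>

definition graded_sum :: "(nat \<Rightarrow> (complex \<Rightarrow> complex) set) \<Rightarrow> (nat \<Rightarrow> complex \<Rightarrow> complex) set" where
  "graded_sum V = {F. (\<forall>k. F k \<in> V k) \<and> finite {k. F k \<noteq> (\<lambda>\<tau>. 0)}}"

definition homogeneous ::
    "nat \<Rightarrow> (complex \<Rightarrow> complex) \<Rightarrow> nat \<Rightarrow> complex \<Rightarrow> complex" where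
  "homogeneous k f j \<tau> = (if j = k \<and> \<tau> \<in> upper_half_plane then f \<tau> else 0)"

definition modular_forms_ring :: "nat \<Rightarrow> (nat \<Rightarrow> complex \<Rightarrow> complex) ring" where
  "modular_forms_ring N =
     \<lparr>carrier = graded_sum (modular_forms N),
      monoid.mult = (\<lambda>F G k \<tau>. \<Sum>i\<le>k. F i \<tau> * G (k - i) \<tau>),
      one = homogeneous 0 (\<lambda>\<tau>. 1),
      zero = (\<lambda>k \<tau>. 0),
      add = (\<lambda>F G k \<tau>. F k \<tau> + G k \<tau>)\<rparr>"

definition cusp_forms_ideal :: "nat \<Rightarrow> (nat \<Rightarrow> complex \<Rightarrow> complex) set" where
  "cusp_forms_ideal N = graded_sum (cusp_forms N)"

definition dedekind_eta :: "complex \<Rightarrow> complex" where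
  "dedekind_eta \<tau> =
     exp (2 * of_real pi * \<i> * \<tau> / 24) *
     (\<Prod>n. 1 - exp (2 * of_real pi * \<i> * of_nat (Suc n) * \<tau>))"

text \<open>
  Since \<open>\<eta>\<close> has weight \<open>1/2\<close>, the power \<open>\<eta>\<^sup>2\<^sup>4\<^sup>/\<^sup>N\<close> lives in weight \<open>12/N\<close>. Both divisions are exact
  for every divisor \<open>N\<close> of \<open>12\<close>.
\<close>

definition eta_power :: "nat \<Rightarrow> nat \<Rightarrow> complex \<Rightarrow> complex" where
  "eta_power N = homogeneous (12 div N) (\<lambda>\<tau>. dedekind_eta \<tau> ^ (24 div N))"

end

theory Submission
  imports Defs
begin

text \<open>
  The eta function has no zeros on the upper half-plane, and at every cusp of \<open>\<Gamma>(N)\<close> the function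
  \<open>E = \<eta>\<^bsup>24/N\<^esup>\<close> vanishes to first order in the local parameter \<open>x = exp(2\<pi>i\<tau>/N)\<close>: it equals \<open>x\<close> times a
  function that is holomorphic and zero-free on the unit disc. So a cusp form \<open>f\<close> can be divided by \<open>E\<close>
  without creating poles, on the upper half-plane or at a cusp. If \<open>E\<close> is a modular form of weight
  \<open>w = 12/N\<close> for \<open>\<Gamma>(N)\<close>, then the quotient \<open>f/E\<close> is a modular form of weight \<open>k - w\<close>, and the theorem
  follows, except that \<open>f = 0\<close> needs an argument when \<open>k < w\<close>.

  Modularity of \<open>E\<close>. As \<open>E\<close> is a power of \<open>\<eta>\<^sup>2\<close>, only integral weights occur and no square roots have to
  be chosen. The formula \<open>\<eta>\<^sup>2(-1/\<tau>) = -i\<tau>\<eta>\<^sup>2(\<tau>)\<close> is derived from the Jacobi theta function, defined as an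
  infinite product \<open>\<theta>(z,\<tau>)\<close>. As functions of \<open>z\<close>, \<open>\<theta>(z,\<tau>)\<close> and \<open>exp(-\<pi>iz\<^sup>2/\<tau>)\<theta>(z/\<tau>,-1/\<tau>)\<close> obey the same
  quasi-periodicity laws and vanish on the same lattice, so by Liouville's theorem they differ by a
  factor \<open>C(\<tau>)\<close> (\<open>quasi_periodic_imp_multiple_of_theta\<close>). Their derivatives at \<open>0\<close> express \<open>C(\<tau>)\<close> by
  \<open>\<eta>\<^sup>2(-1/\<tau>)/\<eta>\<^sup>2(\<tau>)\<close>. The product of the values at the three half-periods is elementary by an identity of
  Euler, which gives \<open>C(\<tau>)\<^sup>3\<close>. Hence \<open>\<eta>\<^sup>2(-1/\<tau>)/(\<tau>\<eta>\<^sup>2(\<tau>))\<close> is a cube root of \<open>i\<close>, is constant by continuity,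
  and is read off at the fixed point \<open>\<tau> = i\<close> (\<open>dedekind_eta_squared_inversion\<close>). Together with
  \<open>\<eta>\<^sup>2(\<tau>+1) = exp(2\<pi>i/12)\<eta>\<^sup>2(\<tau>)\<close> this determines the multiplier of \<open>\<eta>\<^sup>2\<close> on the full modular group. It is
  \<open>exp(2\<pi>i\<phi>/12)\<close> for an integer polynomial \<open>\<phi>\<close> in the matrix entries
  (\<open>dedekind_eta_squared_fractional_linear\<close>). The multiplier of \<open>E\<close> is then \<open>exp(2\<pi>i\<phi>/N)\<close>, which is \<open>1\<close> on
  \<open>\<Gamma>(N)\<close> because \<open>\<phi>\<close> vanishes at the identity matrix.

  Small weight. If \<open>k < w\<close>, then \<open>f/E\<close> behaves like a modular form of negative weight. It is bounded
  near the cusps, so transporting a point of small height \<open>y\<close> up to height at least \<open>1/2\<close> shows that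
  \<open>|f/E|\<close> is at most a constant times \<open>\<surd>y\<close>. Thus the holomorphic function of \<open>x\<close> that represents \<open>f/E\<close> tends
  to \<open>0\<close> at the unit circle, and is \<open>0\<close> by the maximum principle
  (\<open>cusp_form_of_small_weight_eq_0\<close>).
\<close>

(* the symbol $ is reserved for matrix entries *)
no_notation fps_nth (infixl \<open>$\<close> 75)

section \<open>Infinite q-products\<close>

definition q_product :: "complex \<Rightarrow> complex \<Rightarrow> complex" where
  "q_product x q = (\<Prod>n. 1 - x * q ^ n)"

lemma q_product_convergent:
  fixes x q :: complex
  assumes "norm q < 1"
  shows "convergent_prod (\<lambda>n. 1 - x * q ^ n)"
proof (intro abs_convergent_prod_imp_convergent_prod summable_imp_abs_convergent_prod)
  have "summable (\<lambda>n. norm x * norm q ^ n)"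
    using assms by (intro summable_mult summable_geometric) auto
  thus "summable (\<lambda>n. norm (1 - x * q ^ n - 1))"
    by (simp add: norm_mult norm_power)
qed

lemma q_product_LIMSEQ:
  assumes "norm q < 1"
  shows "(\<lambda>n. \<Prod>k<n. 1 - x * q ^ k) \<longlonglongrightarrow> q_product x q"
proof -
  have "(\<lambda>n. \<Prod>k\<le>n. 1 - x * q ^ k) \<longlonglongrightarrow> q_product x q"
    unfolding q_product_def by (rule convergent_prod_LIMSEQ[OF q_product_convergent[OF assms]])
  hence "(\<lambda>n. \<Prod>k<Suc n. 1 - x * q ^ k) \<longlonglongrightarrow> q_product x q"
    by (simp only: lessThan_Suc_atMost)
  thus ?thesis by (rule LIMSEQ_imp_Suc)
qed

text \<open>
  This functional equation is what turns a shift of the argument by a period into an elementary factor;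
  it replaces any division by factors that might vanish.
\<close>

lemma q_product_rec:
  assumes "norm q < 1"
  shows "q_product x q = (1 - x) * q_product (x * q) q"
proof (rule LIMSEQ_unique)
  show "(\<lambda>n. \<Prod>k<Suc n. 1 - x * q ^ k) \<longlonglongrightarrow> q_product x q"
    by (rule LIMSEQ_Suc[OF q_product_LIMSEQ[OF assms]])
  have "(\<Prod>k<Suc n. 1 - x * q ^ k) = (1 - x) * (\<Prod>k<n. 1 - (x * q) * q ^ k)" for n
    by (subst prod.lessThan_Suc_shift) (simp add: mult.assoc)
  thus "(\<lambda>n. \<Prod>k<Suc n. 1 - x * q ^ k) \<longlonglongrightarrow> (1 - x) * q_product (x * q) q"
    by (simp only:) (intro tendsto_intros q_product_LIMSEQ assms)
qed

lemma q_product_eq_0_iff: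
  assumes "norm q < 1"
  shows "q_product x q = 0 \<longleftrightarrow> (\<exists>n. x * q ^ n = 1)"
proof
  assume "q_product x q = 0"
  thus "\<exists>n. x * q ^ n = 1"
    using prodinf_nonzero[OF q_product_convergent[OF assms], of x]
    by (auto simp: q_product_def)
next
  assume "\<exists>n. x * q ^ n = 1"
  then obtain n where n: "x * q ^ n = 1" by blast
  have "q_product y q = 0" if "y * q ^ m = 1" for m y
    using that
  proof (induction m arbitrary: y)
    case 0
    thus ?case using q_product_rec[OF assms, of y] by simp
  next
    case (Suc m)
    hence "q_product (y * q) q = 0" by (simp add: mult.assoc)
    thus ?case using q_product_rec[OF assms, of y] by simp
  qed
  thus "q_product x q = 0" using n by blast
qed

lemma q_product_even_odd:
  assumes "norm q < 1"
  shows "q_product x q = q_product x (q\<^sup>2) * q_product (x * q) (q\<^sup>2)"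
proof (rule LIMSEQ_unique)
  have q2: "norm (q\<^sup>2) < 1"
    using assms by (simp add: norm_power power_less_one_iff)
  have "filterlim (\<lambda>n::nat. 2 * n) sequentially sequentially"
    by (rule filterlim_subseq) (auto intro: strict_monoI)
  thus "(\<lambda>n. \<Prod>k<2*n. 1 - x * q ^ k) \<longlonglongrightarrow> q_product x q"
    by (rule filterlim_compose[OF q_product_LIMSEQ[OF assms]])
  have "(\<Prod>k<2*n. 1 - x * q ^ k) =
      (\<Prod>k<n. 1 - x * (q\<^sup>2) ^ k) * (\<Prod>k<n. 1 - (x * q) * (q\<^sup>2) ^ k)" for n
    by (induction n) (auto simp: power_mult mult_ac simp flip: power_mult)
  thus "(\<lambda>n. \<Prod>k<2*n. 1 - x * q ^ k) \<longlonglongrightarrow> q_product x (q\<^sup>2) * q_product (x * q) (q\<^sup>2)"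
    by (simp only:) (intro tendsto_intros q_product_LIMSEQ q2)
qed

lemma q_product_plus_minus:
  assumes "norm q < 1"
  shows "q_product x q * q_product (- x) q = q_product (x\<^sup>2) (q\<^sup>2)"
proof (rule LIMSEQ_unique)
  have q2: "norm (q\<^sup>2) < 1"
    using assms by (simp add: norm_power power_less_one_iff)
  show "(\<lambda>n. \<Prod>k<n. 1 - x\<^sup>2 * (q\<^sup>2) ^ k) \<longlonglongrightarrow> q_product (x\<^sup>2) (q\<^sup>2)"
    by (rule q_product_LIMSEQ[OF q2])
  have "(\<Prod>k<n. 1 - x\<^sup>2 * (q\<^sup>2) ^ k) = (\<Prod>k<n. 1 - x * q ^ k) * (\<Prod>k<n. 1 - (- x) * q ^ k)" for n
    by (simp add: prod.distrib[symmetric] algebra_simps power2_eq_square power_mult_distrib)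
  thus "(\<lambda>n. \<Prod>k<n. 1 - x\<^sup>2 * (q\<^sup>2) ^ k) \<longlonglongrightarrow> q_product x q * q_product (- x) q"
    by (simp only:) (intro tendsto_intros q_product_LIMSEQ assms)
qed

text \<open>
  Euler's identity \<open>\<Prod>(1 + q\<^sup>n)(1 - q\<^bsup>2n-1\<^esup>) = 1\<close> with \<open>q = r\<^sup>2\<close>, after splitting \<open>1 - q\<^bsup>2n-1\<^esup>\<close> into
  \<open>(1 - r\<^bsup>2n-1\<^esup>)(1 + r\<^bsup>2n-1\<^esup>)\<close>: multiplying by \<open>\<Prod>(1 - q\<^bsup>2n\<^esup>)\<close> gives \<open>\<Prod>(1 + q\<^sup>n)(1 - q\<^sup>n)\<close>, which is the same
  product again. It makes the three half-period values of \<open>theta\<close> multiply to an exponential.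
\<close>

lemma q_product_euler:
  assumes "norm r < 1"
  shows "q_product (- (r\<^sup>2)) (r\<^sup>2) * q_product r (r\<^sup>2) * q_product (- r) (r\<^sup>2) = 1"
proof -
  define q where "q = r\<^sup>2"
  have q: "norm q < 1" "norm (q\<^sup>2) < 1"
    using assms by (simp_all add: q_def norm_power power_less_one_iff)
  have "q_product q q * q_product (- q) q = q_product (q\<^sup>2) (q\<^sup>2)"
    by (rule q_product_plus_minus[OF q(1)])
  also have "q_product q q = q_product q (q\<^sup>2) * q_product (q\<^sup>2) (q\<^sup>2)"
    using q_product_even_odd[OF q(1), of q] by (simp add: power2_eq_square)
  finally have eq: "q_product (q\<^sup>2) (q\<^sup>2) * (q_product q (q\<^sup>2) * q_product (- q) q) =
      q_product (q\<^sup>2) (q\<^sup>2) * 1"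
    by (simp add: mult_ac)
  have "norm (q\<^sup>2 * (q\<^sup>2) ^ n) < 1" for n
    using q(2) power_less_one_iff[of "norm (q\<^sup>2)" "Suc n"] by (simp add: norm_power norm_mult)
  hence "q_product (q\<^sup>2) (q\<^sup>2) \<noteq> 0"
    using q_product_eq_0_iff[OF q(2), of "q\<^sup>2"] by (metis norm_one less_irrefl)
  with eq have "q_product q (q\<^sup>2) * q_product (- q) q = 1"
    by (metis mult_left_cancel)
  moreover have "q_product r q * q_product (- r) q = q_product q (q\<^sup>2)"
    using q_product_plus_minus[OF q(1), of r] by (simp add: q_def)
  ultimately show ?thesis
    unfolding q_def[symmetric] by (metis mult.assoc mult.commute)
qed

text \<open>
  On a compact disc \<open>u\<close> is bounded by some \<open>M\<close> and \<open>|v|\<close> by its maximum \<open>r < 1\<close>, so that the geometric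
  series \<open>\<Sum>M r\<^sup>n\<close> yields locally uniform convergence. With both arguments variable the lemma covers \<open>theta\<close>
  as a function of \<open>z\<close> as well as \<open>\<eta>\<close> as a function of \<open>\<tau>\<close> or of \<open>q\<close>.
\<close>

lemma holomorphic_on_q_product [holomorphic_intros]:
  assumes S: "open S" and u: "u holomorphic_on S" and v: "v holomorphic_on S"
    and v1: "\<And>z. z \<in> S \<Longrightarrow> norm (v z) < 1"
  shows "(\<lambda>z. q_product (u z) (v z)) holomorphic_on S"
proof (rule holomorphic_uniform_sequence[OF S])
  show "(\<lambda>z. \<Prod>k<n. 1 - u z * v z ^ k) holomorphic_on S" for n
    by (intro holomorphic_intros u v)
  fix z assume "z \<in> S"
  then obtain d where d: "d > 0" "cball z d \<subseteq> S"
    using S open_contains_cball by blast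
  have cu: "continuous_on (cball z d) u" and cv: "continuous_on (cball z d) v"
    using u v d holomorphic_on_imp_continuous_on continuous_on_subset by blast+
  obtain M where M: "\<And>w. w \<in> cball z d \<Longrightarrow> norm (u w) \<le> M"
    using compact_imp_bounded[OF compact_continuous_image[OF cu compact_cball]]
    unfolding bounded_iff by blast
  have "\<exists>w\<in>cball z d. \<forall>y\<in>cball z d. norm (v y) \<le> norm (v w)"
    using d by (intro continuous_attains_sup continuous_intros cv) auto
  then obtain w where w: "w \<in> cball z d" "\<And>y. y \<in> cball z d \<Longrightarrow> norm (v y) \<le> norm (v w)"
    by blast
  have M0: "M \<ge> 0" using M[OF w(1)] norm_ge_zero order_trans by blast
  have r: "norm (v w) < 1" using v1 w d by blast
  have sumr: "summable (\<lambda>n. M * norm (v w) ^ n)"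
    using r by (intro summable_mult summable_geometric) auto
  have "uniformly_convergent_on (cball z d) (\<lambda>N y. \<Sum>n<N. norm ((1 - u y * v y ^ n) - 1))"
  proof (rule Weierstrass_m_test'[OF _ sumr])
    fix n y assume "y \<in> cball z d"
    thus "norm (norm ((1 - u y * v y ^ n) - 1)) \<le> M * norm (v w) ^ n"
      using M0 by (auto simp: norm_mult norm_power intro!: mult_mono power_mono M w)
  qed
  hence "uniformly_convergent_on (cball z d) (\<lambda>N y. \<Prod>n<N. 1 - u y * v y ^ n)"
    by (intro uniformly_convergent_on_prod' continuous_intros cu cv) auto
  then obtain l where l: "uniform_limit (cball z d) (\<lambda>N y. \<Prod>n<N. 1 - u y * v y ^ n) l sequentially"
    by (auto simp: uniformly_convergent_on_def)
  have "l y = q_product (u y) (v y)" if "y \<in> cball z d" for y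
  proof (rule LIMSEQ_unique)
    show "(\<lambda>N. \<Prod>n<N. 1 - u y * v y ^ n) \<longlonglongrightarrow> l y"
      by (rule tendsto_uniform_limitI[OF l that])
    show "(\<lambda>N. \<Prod>n<N. 1 - u y * v y ^ n) \<longlonglongrightarrow> q_product (u y) (v y)"
      using that d v1 by (intro q_product_LIMSEQ) auto
  qed
  hence "uniform_limit (cball z d) (\<lambda>N y. \<Prod>n<N. 1 - u y * v y ^ n) (\<lambda>y. q_product (u y) (v y)) sequentially"
    by (rule uniform_limit_cong'[OF refl, THEN iffD1, rotated, OF l])
  thus "\<exists>d>0. cball z d \<subseteq> S \<and> uniform_limit (cball z d) (\<lambda>N y. \<Prod>n<N. 1 - u y * v y ^ n)
           (\<lambda>z. q_product (u z) (v z)) sequentially"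
    using d by blast
qed

section \<open>A theta function\<close>

definition unit_exp :: "complex \<Rightarrow> complex" where
  "unit_exp z = exp (2 * of_real pi * \<i> * z)"

lemma unit_exp_add: "unit_exp (x + y) = unit_exp x * unit_exp y"
  by (simp add: unit_exp_def exp_add[symmetric] algebra_simps)

lemma unit_exp_minus: "unit_exp (- x) = inverse (unit_exp x)"
  by (simp add: unit_exp_def exp_minus)

lemma unit_exp_diff: "unit_exp (x - y) = unit_exp x / unit_exp y"
  using unit_exp_add[of x "- y"] by (simp add: unit_exp_minus field_simps)

lemma unit_exp_nonzero [simp]: "unit_exp x \<noteq> 0"
  by (simp add: unit_exp_def)

lemma unit_exp_0 [simp]: "unit_exp 0 = 1"
  by (simp add: unit_exp_def)

lemma unit_exp_of_nat_mult: "unit_exp (of_nat n * z) = unit_exp z ^ n"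
  by (simp add: unit_exp_def exp_of_nat_mult[symmetric] mult_ac)

lemma unit_exp_eq_1_iff: "unit_exp z = 1 \<longleftrightarrow> (\<exists>n::int. z = of_int n)"
proof -
  have "unit_exp z = 1 \<longleftrightarrow> (\<exists>n::int. 2 * of_real pi * \<i> * z = 2 * of_real pi * \<i> * of_int n)"
    unfolding unit_exp_def exp_eq_1
    by (auto simp: complex_eq_iff field_simps)
  thus ?thesis by auto
qed

lemma unit_exp_of_int [simp]: "unit_exp (of_int n) = 1"
  using unit_exp_eq_1_iff by blast

lemma unit_exp_1 [simp]: "unit_exp 1 = 1"
  using unit_exp_of_int[of 1] by simp

lemma unit_exp_half [simp]: "unit_exp (1 / 2) = -1"
  by (simp add: unit_exp_def)

lemma unit_exp_quarter [simp]: "unit_exp (1 / 4) = \<i>"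
proof -
  have "unit_exp (1 / 4) = cis (pi / 2)"
    unfolding unit_exp_def cis_conv_exp by (rule arg_cong[of _ _ exp]) simp
  thus ?thesis by simp
qed

lemma norm_unit_exp: "norm (unit_exp z) = exp (- 2 * pi * Im z)"
  by (simp add: unit_exp_def)

lemma norm_unit_exp_less_1_iff [simp]: "norm (unit_exp z) < 1 \<longleftrightarrow> Im z > 0"
  by (simp add: norm_unit_exp zero_less_mult_iff)

lemma unit_exp_holomorphic [holomorphic_intros]:
  "f holomorphic_on S \<Longrightarrow> (\<lambda>z. unit_exp (f z)) holomorphic_on S"
  unfolding unit_exp_def by (intro holomorphic_intros)

lemma unit_exp_deriv [derivative_intros]:
  "(f has_field_derivative f') (at z) \<Longrightarrow>
    ((\<lambda>z. unit_exp (f z)) has_field_derivative 2 * of_real pi * \<i> * f' * unit_exp (f z)) (at z)"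
  unfolding unit_exp_def by (auto intro!: derivative_eq_intros)

text \<open>
  By the triple product identity this is, up to a factor depending only on \<open>t\<close>, Jacobi's odd theta
  function.
\<close>

definition theta :: "complex \<Rightarrow> complex \<Rightarrow> complex" where
  "theta z t = unit_exp (z / 2) *
     q_product (unit_exp (- z)) (unit_exp t) * q_product (unit_exp (t + z)) (unit_exp t)"

lemma theta_eq_0_iff:
  assumes "Im t > 0"
  shows "theta z t = 0 \<longleftrightarrow> (\<exists>m n::int. z = of_int m + of_int n * t)"
proof -
  have q: "norm (unit_exp t) < 1" using assms by simp
  show ?thesis
  proof
    assume "theta z t = 0"
    then consider "q_product (unit_exp (- z)) (unit_exp t) = 0"
      | "q_product (unit_exp (t + z)) (unit_exp t) = 0"
      by (auto simp: theta_def)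
    thus "\<exists>m n::int. z = of_int m + of_int n * t"
    proof cases
      case 1
      then obtain n :: nat where "unit_exp (- z + of_nat n * t) = 1"
        unfolding q_product_eq_0_iff[OF q] unit_exp_add unit_exp_of_nat_mult by blast
      then obtain k :: int where "- z + of_nat n * t = of_int k"
        by (auto simp: unit_exp_eq_1_iff)
      hence "z = of_int (- k) + of_int (int n) * t"
        by (simp add: algebra_simps)
      thus ?thesis by blast
    next
      case 2
      then obtain n :: nat where "unit_exp ((t + z) + of_nat n * t) = 1"
        unfolding q_product_eq_0_iff[OF q] unit_exp_add unit_exp_of_nat_mult by blast
      then obtain k :: int where "(t + z) + of_nat n * t = of_int k"
        by (auto simp: unit_exp_eq_1_iff)
      hence "z = of_int k + of_int (- int n - 1) * t"
        by (simp add: algebra_simps)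
      thus ?thesis by blast
    qed
  next
    assume "\<exists>m n::int. z = of_int m + of_int n * t"
    then obtain m n :: int where z: "z = of_int m + of_int n * t" by blast
    show "theta z t = 0"
    proof (cases "n \<ge> 0")
      case True
      have "unit_exp (- z) * unit_exp t ^ nat n = unit_exp (- z + of_nat (nat n) * t)"
        by (simp only: unit_exp_add unit_exp_of_nat_mult)
      also have "- z + of_nat (nat n) * t = of_int (- m)"
        using True by (simp add: z)
      finally have "unit_exp (- z) * unit_exp t ^ nat n = 1"
        by (simp only: unit_exp_of_int)
      thus ?thesis using q_product_eq_0_iff[OF q] by (auto simp: theta_def)
    next
      case False
      have "unit_exp (t + z) * unit_exp t ^ nat (- n - 1) = unit_exp (t + z + of_nat (nat (- n - 1)) * t)"
        by (simp only: unit_exp_add unit_exp_of_nat_mult)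
      also have "t + z + of_nat (nat (- n - 1)) * t = of_int m"
        using False by (simp add: z algebra_simps)
      finally have "unit_exp (t + z) * unit_exp t ^ nat (- n - 1) = 1"
        by (simp only: unit_exp_of_int)
      thus ?thesis using q_product_eq_0_iff[OF q] by (auto simp: theta_def)
    qed
  qed
qed

lemma theta_add_1: "theta (z + 1) t = - theta z t"
proof -
  have "unit_exp (- (z + 1)) = unit_exp (- z)" "unit_exp (t + (z + 1)) = unit_exp (t + z)"
    "unit_exp ((z + 1) / 2) = - unit_exp (z / 2)"
    using unit_exp_half unfolding add_divide_distrib minus_add_distrib unit_exp_add unit_exp_minus by auto
  thus ?thesis by (simp add: theta_def)
qed

lemma theta_add_period:
  assumes "Im t > 0"
  shows "theta (z + t) t = - unit_exp (- t / 2 - z) * theta z t"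
proof -
  define q x where "q = unit_exp t" and "x = unit_exp z"
  have nz: "q \<noteq> 0" "x \<noteq> 0" by (simp_all add: q_def x_def)
  have q: "norm q < 1" using assms by (simp add: q_def)
  have "theta (z + t) t = unit_exp (z / 2) * unit_exp (t / 2) *
      q_product (inverse (x * q)) q * q_product (q * x * q) q"
    unfolding theta_def add_divide_distrib unit_exp_add unit_exp_minus
    by (simp add: q_def x_def mult_ac)
  also have "q_product (inverse (x * q)) q = (1 - inverse (x * q)) * q_product (inverse x) q"
  proof -
    have "inverse (x * q) * q = inverse x" using nz by (simp add: field_simps)
    thus ?thesis using q_product_rec[OF q, of "inverse (x * q)"] by metis
  qed
  also have "1 - inverse (x * q) = - inverse (x * q) * (1 - q * x)"
    using nz by (simp add: field_simps)
  also have "unit_exp (z / 2) * unit_exp (t / 2) *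
      (- inverse (x * q) * (1 - q * x) * q_product (inverse x) q) * q_product (q * x * q) q =
      - (unit_exp (t / 2) * inverse (x * q)) * (unit_exp (z / 2) * q_product (inverse x) q *
        ((1 - q * x) * q_product (q * x * q) q))"
    by (simp add: mult_ac)
  also have "(1 - q * x) * q_product (q * x * q) q = q_product (q * x) q"
    by (rule q_product_rec[OF q, symmetric])
  also have "unit_exp (z / 2) * q_product (inverse x) q * q_product (q * x) q = theta z t"
    by (simp add: theta_def q_def x_def unit_exp_add unit_exp_minus)
  also have "unit_exp (t / 2) * inverse (x * q) = unit_exp (- t / 2 - z)"
  proof -
    have "unit_exp (t / 2) * inverse (x * q) = unit_exp (t / 2 + - (z + t))"
      unfolding x_def q_def unit_exp_add unit_exp_minus by simp
    also have "t / 2 + - (z + t) = - t / 2 - z" by (simp add: field_simps)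
    finally show ?thesis .
  qed
  finally show ?thesis .
qed

text \<open>
  The factor that vanishes at \<open>0\<close> is isolated; what remains is even in \<open>z\<close>. This exhibits both the oddness
  of \<open>theta\<close> and its derivative at \<open>0\<close>.
\<close>

lemma theta_eq_sine_mult:
  assumes "Im t > 0"
  shows "theta z t = (unit_exp (z / 2) - unit_exp (- z / 2)) *
    (q_product (unit_exp (t - z)) (unit_exp t) * q_product (unit_exp (t + z)) (unit_exp t))"
proof -
  have q: "norm (unit_exp t) < 1" using assms by simp
  have "q_product (unit_exp (- z)) (unit_exp t) =
      (1 - unit_exp (- z)) * q_product (unit_exp (t - z)) (unit_exp t)"
    using q_product_rec[OF q, of "unit_exp (- z)"] by (simp add: unit_exp_add[symmetric])
  moreover have "unit_exp (z / 2) * (1 - unit_exp (- z)) = unit_exp (z / 2) - unit_exp (- z / 2)"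
    by (simp add: right_diff_distrib unit_exp_add[symmetric])
  ultimately show ?thesis
    unfolding theta_def by (simp add: mult.assoc[symmetric])
qed

lemma theta_minus:
  assumes "Im t > 0"
  shows "theta (- z) t = - theta z t"
  by (simp add: theta_eq_sine_mult[OF assms] algebra_simps)

lemma theta_0 [simp]: "Im t > 0 \<Longrightarrow> theta 0 t = 0"
  by (simp add: theta_eq_sine_mult)

lemma theta_holomorphic:
  assumes "Im t > 0"
  shows "(\<lambda>z. theta z t) holomorphic_on S"
proof (rule holomorphic_on_subset)
  show "(\<lambda>z. theta z t) holomorphic_on UNIV"
    unfolding theta_def using assms by (intro holomorphic_intros) auto
qed auto

lemma theta_has_field_derivative_0:
  assumes "Im t > 0"
  shows "((\<lambda>z. theta z t) has_field_derivative
    2 * of_real pi * \<i> * q_product (unit_exp t) (unit_exp t) ^ 2) (at 0)"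
proof -
  define h where "h = (\<lambda>z. q_product (unit_exp (t - z)) (unit_exp t) * q_product (unit_exp (t + z)) (unit_exp t))"
  have "h holomorphic_on UNIV"
    unfolding h_def using assms by (intro holomorphic_intros) auto
  hence h': "(h has_field_derivative deriv h 0) (at 0)"
    by (intro holomorphic_derivI[of h UNIV]) auto
  have "((\<lambda>z. (unit_exp (z / 2) - unit_exp (- z / 2)) * h z) has_field_derivative
      2 * of_real pi * \<i> * h 0) (at 0)"
    by (auto intro!: derivative_eq_intros h' simp: field_simps)
  thus ?thesis
    using assms by (simp add: theta_eq_sine_mult h_def power2_eq_square)
qed

text \<open>
  The quotient \<open>h = f/theta\<close> is doubly periodic. The zeros of \<open>theta\<close> are the lattice points, and the one at
  \<open>0\<close> is simple, so \<open>f(0) = 0\<close> makes the singularity of \<open>h\<close> at \<open>0\<close> removable; by periodicity all others are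
  removable too. An entire doubly periodic function is bounded by its values on one period
  parallelogram, hence constant.
\<close>

lemma quasi_periodic_imp_multiple_of_theta:
  assumes t: "Im t > 0" and hol: "f holomorphic_on UNIV"
    and f1: "\<And>z. f (z + 1) = - f z" and ft: "\<And>z. f (z + t) = - unit_exp (- t / 2 - z) * f z"
    and f0: "f 0 = 0"
  obtains C where "\<And>z. f z = C * theta z t"
proof -
  define g where "g = (\<lambda>z. theta z t)"
  define L where "L = {of_int m + of_int n * t | m n :: int. True}"
  define c where "c = deriv f 0 / deriv g 0"
  define h where "h = (\<lambda>z. if z \<in> L then c else f z / g z)"
  have g0_iff: "g z = 0 \<longleftrightarrow> z \<in> L" for z
    by (simp add: g_def L_def theta_eq_0_iff[OF t])
  have gh: "g holomorphic_on UNIV"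
    unfolding g_def by (rule theta_holomorphic[OF t])
  have g'0: "deriv g 0 \<noteq> 0"
  proof -
    have "unit_exp t * unit_exp t ^ n \<noteq> 1" for n
    proof -
      have "norm (unit_exp t) ^ Suc n < 1"
        using t by (subst power_less_one_iff) auto
      thus ?thesis by (metis norm_one norm_power power_Suc less_irrefl)
    qed
    hence "q_product (unit_exp t) (unit_exp t) \<noteq> 0"
      using t by (subst q_product_eq_0_iff) auto
    thus ?thesis
      using DERIV_imp_deriv[OF theta_has_field_derivative_0[OF t]] by (simp add: g_def)
  qed
  have L1: "z + 1 \<in> L \<longleftrightarrow> z \<in> L" for z
    unfolding g0_iff[symmetric] by (simp add: g_def theta_add_1)
  have Lt: "z + t \<in> L \<longleftrightarrow> z \<in> L" for z
    unfolding g0_iff[symmetric] by (simp add: g_def theta_add_period[OF t])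
  have h1: "h (z + 1) = h z" for z
    by (simp add: h_def L1 f1 g_def theta_add_1)
  have ht: "h (z + t) = h z" for z
    by (simp add: h_def Lt ft g_def theta_add_period[OF t])
  have per: "F (z + of_int n * w) = F z" if "\<And>z. F (z + w) = F z"
    for F :: "complex \<Rightarrow> 'b" and w z n
  proof (induction n arbitrary: z rule: int_induct[of _ 0])
    case (step1 i)
    thus ?case using that[of "z + of_int i * w"] by (simp add: algebra_simps)
  next
    case (step2 i)
    thus ?case using that[of "z + of_int (i - 1) * w"] by (simp add: algebra_simps)
  qed simp
  have hL: "h (z + w) = h z" if "w \<in> L" for w z
  proof -
    from that obtain m n :: int where w: "w = of_int m + of_int n * t" by (auto simp: L_def)
    have "h (z + w) = h ((z + of_int m * 1) + of_int n * t)" by (simp add: w add_ac)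
    also have "\<dots> = h z" using per[of h, OF ht] per[of h, OF h1] by metis
    finally show ?thesis .
  qed
  have fL: "f w = 0" if "w \<in> L" for w
  proof -
    from that obtain m n :: int where w: "w = of_int m + of_int n * t" by (auto simp: L_def)
    have "(f ((0 + of_int m * 1) + of_int n * t) = 0) = (f 0 = 0)"
      using per[of "\<lambda>z. f z = 0" t "0 + of_int m * 1" n] per[of "\<lambda>z. f z = 0" 1 0 m] by (simp add: f1 ft)
    thus ?thesis by (simp add: w f0)
  qed
  \<comment> \<open>near \<open>0\<close>, numerator and denominator are both divided by \<open>z\<close>\<close>
  have diff_off: "h field_differentiable (at z)" if "z = 0 \<or> z \<notin> L" for z
  proof -
    define F where "F = (\<lambda>z. if z = 0 then deriv f 0 else (f z - f 0) / (z - 0))"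
    define G where "G = (\<lambda>z. if z = 0 then deriv g 0 else (g z - g 0) / (z - 0))"
    have FG: "F holomorphic_on UNIV" "G holomorphic_on UNIV"
      unfolding F_def G_def using pole_lemma_open[OF hol] pole_lemma_open[OF gh] by auto
    have g0: "g 0 = 0" using t by (simp add: g_def)
    have G0: "G z \<noteq> 0 \<longleftrightarrow> z = 0 \<or> z \<notin> L" for z
      using g'0 by (auto simp: G_def g0 g0_iff)
    define U where "U = {z. G z \<noteq> 0}"
    have "open U"
      unfolding U_def using FG(2)
      by (intro open_Collect_neq holomorphic_on_imp_continuous_on continuous_intros)
    have zL: "0 \<in> L" using g0 g0_iff by blast
    have GU: "z \<in> U \<longleftrightarrow> z = 0 \<or> z \<notin> L" for z
      unfolding U_def using G0 by blast
    have "(\<lambda>z. F z / G z) holomorphic_on U"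
      using FG by (intro holomorphic_intros) (auto simp: U_def intro: holomorphic_on_subset)
    moreover have "F z / G z = h z" if "z \<in> U" for z
      using that zL by (auto simp: GU h_def F_def G_def g0 f0 c_def)
    ultimately have "h holomorphic_on U"
      by (rule holomorphic_transform)
    thus ?thesis
      using \<open>open U\<close> that by (intro holomorphic_on_imp_differentiable_at[of _ U]) (simp_all add: GU)
  qed
  have "h field_differentiable (at z)" for z
  proof (cases "z \<in> L")
    case True
    then obtain m n :: int where w: "z = of_int m + of_int n * t" by (auto simp: L_def)
    have "- z = of_int (- m) + of_int (- n) * t" by (simp add: w)
    hence mz: "- z \<in> L" unfolding L_def by blast
    have "h (w - z) = h w" for w
      using hL[OF mz, of w] by simp
    hence eq: "(h \<circ> (\<lambda>w. w - z)) = h"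
      by (simp add: fun_eq_iff)
    have "(h \<circ> (\<lambda>w. w - z)) field_differentiable (at z)"
      by (intro field_differentiable_compose field_differentiable_diff field_differentiable_ident
            field_differentiable_const) (simp add: diff_off)
    thus ?thesis by (simp only: eq)
  qed (simp add: diff_off)
  hence hh: "h holomorphic_on UNIV"
    by (simp add: holomorphic_on_def)
  \<comment> \<open>the period parallelogram\<close>
  define K where "K = (\<lambda>(s, r). of_real s + of_real r * t) ` ({0..1} \<times> {0..1::real})"
  have "compact K"
    unfolding K_def case_prod_unfold
    by (intro compact_continuous_image compact_Times continuous_intros) auto
  hence "compact (h ` K)"
    by (intro compact_continuous_image holomorphic_on_imp_continuous_on holomorphic_on_subset[OF hh]) auto
  moreover have "range h \<subseteq> h ` K"
  proof safe
    fix z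
    define r where "r = Im z / Im t"
    define s where "s = Re z - r * Re t"
    have z: "z = of_real s + of_real r * t"
      using t by (simp add: complex_eq_iff s_def r_def)
    have "of_real (frac s) + of_real (frac r) * t + (of_int \<lfloor>s\<rfloor> + of_int \<lfloor>r\<rfloor> * t) = z"
      unfolding z frac_def by (simp add: algebra_simps)
    hence "h z = h (of_real (frac s) + of_real (frac r) * t)"
      using hL[of "of_int \<lfloor>s\<rfloor> + of_int \<lfloor>r\<rfloor> * t" "of_real (frac s) + of_real (frac r) * t"]
      by (auto simp: L_def)
    moreover have "of_real (frac s) + of_real (frac r) * t \<in> K"
      unfolding K_def by (rule image_eqI[of _ _ "(frac s, frac r)"]) (auto simp: less_imp_le frac_lt_1)
    ultimately show "h z \<in> h ` K" by blast
  qed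
  ultimately have "bounded (range h)"
    using bounded_subset compact_imp_bounded by blast
  from Liouville_theorem[OF hh this] obtain C where C: "\<And>z. h z = C"
    by (auto simp: constant_on_def)
  have "f z = C * theta z t" for z
    using C[of z] fL[of z] g0_iff[of z] by (cases "z \<in> L") (auto simp: h_def g_def)
  thus ?thesis using that by blast
qed

text \<open>
  The three values are \<open>2i\<Prod>(1 + q\<^sup>n)\<^sup>2\<close>, \<open>-q\<^bsup>-1/4\<^esup>\<Prod>(1 - q\<^bsup>n-1/2\<^esup>)\<^sup>2\<close> and \<open>iq\<^bsup>-1/4\<^esup>\<Prod>(1 + q\<^bsup>n-1/2\<^esup>)\<^sup>2\<close>. By
  Euler's identity the products cancel.
\<close>

lemma theta_half_periods:
  assumes "Im t > 0"
  shows "theta (1 / 2) t * theta (t / 2) t * theta (1 / 2 + t / 2) t = 2 * unit_exp (- t / 2)"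
proof -
  define r where "r = unit_exp (t / 2)"
  define q where "q = unit_exp t"
  have q: "norm q < 1" "norm r < 1" using assms by (simp_all add: q_def r_def)
  have qr: "q = r\<^sup>2" by (simp add: q_def r_def power2_eq_square unit_exp_add[symmetric])
  have nz: "r \<noteq> 0" "q \<noteq> 0" by (simp_all add: r_def q_def)
  have m: "unit_exp (- (1/2)) = -1" using unit_exp_minus[of "1/2"] by simp
  have "theta (1 / 2) t = \<i> * q_product (- 1) q * q_product (- q) q"
    unfolding theta_def unit_exp_add m by (simp add: q_def)
  also have "q_product (- 1) q = 2 * q_product (- q) q"
    using q_product_rec[OF q(1), of "- 1"] by simp
  finally have 1: "theta (1 / 2) t = 2 * \<i> * q_product (- q) q ^ 2"
    by (simp add: power2_eq_square)
  \<comment> \<open>the two factors of \<open>theta\<close> at a half-period \<open>t/2\<close> or \<open>(1 + t)/2\<close> nearly coincide; the functional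
      equation makes them equal\<close>
  have half_shift: "q_product (x * inverse r) q * q_product (x * r * q) q = - (x * inverse r) * q_product (x * r) q ^ 2"
    if "x = 1 \<or> x = -1" for x
  proof -
    have "x * inverse r * q = x * r"
      using nz by (simp add: qr power2_eq_square)
    hence "q_product (x * inverse r) q = (1 - x * inverse r) * q_product (x * r) q"
      using q_product_rec[OF q(1), of "x * inverse r"] by metis
    also have "1 - x * inverse r = - (x * inverse r) * (1 - x * r)"
      using that nz by (auto simp: field_simps)
    finally show ?thesis
      using q_product_rec[OF q(1), of "x * r"] by (simp add: power2_eq_square mult_ac)
  qed
  have "theta (t / 2) t = unit_exp (t / 4) * (q_product (1 * inverse r) q * q_product (1 * r * q) q)"
    unfolding theta_def unit_exp_add unit_exp_minus by (simp add: q_def r_def mult_ac)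
  also have "\<dots> = - (unit_exp (t / 4) * inverse r) * q_product r q ^ 2"
    unfolding half_shift[OF disjI1[OF refl]] by simp
  finally have 2: "theta (t / 2) t = - (unit_exp (t / 4) * inverse r) * q_product r q ^ 2" .
  have "unit_exp ((1 / 2 + t / 2) / 2) = unit_exp (1 / 4 + t / 4)"
    by (rule arg_cong[of _ _ unit_exp]) simp
  hence "unit_exp ((1 / 2 + t / 2) / 2) = \<i> * unit_exp (t / 4)"
    by (simp add: unit_exp_add)
  moreover have "unit_exp (- (1 / 2 + t / 2)) = - 1 * inverse r"
    "unit_exp (t + (1 / 2 + t / 2)) = - 1 * r * q"
    unfolding minus_add_distrib unit_exp_add unit_exp_minus by (simp_all add: r_def q_def)
  ultimately have "theta (1 / 2 + t / 2) t = \<i> * unit_exp (t / 4) * (q_product (- 1 * inverse r) q * q_product (- 1 * r * q) q)"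
    unfolding theta_def by (simp add: q_def)
  also have "\<dots> = \<i> * (unit_exp (t / 4) * inverse r) * q_product (- r) q ^ 2"
    unfolding half_shift[OF disjI2[OF refl]] by simp
  finally have 3: "theta (1 / 2 + t / 2) t = \<i> * (unit_exp (t / 4) * inverse r) * q_product (- r) q ^ 2" .
  have "theta (1 / 2) t * theta (t / 2) t * theta (1 / 2 + t / 2) t =
      2 * (unit_exp (t / 4) * inverse r) ^ 2 *
      (q_product (- q) q * q_product r q * q_product (- r) q) ^ 2"
    unfolding 1 2 3 by (simp add: power2_eq_square)
  also have "q_product (- q) q * q_product r q * q_product (- r) q = 1"
    using q_product_euler[OF q(2)] by (simp add: qr)
  also have "unit_exp (t / 4) * inverse r = unit_exp (- t / 4)"
    unfolding r_def unit_exp_minus[symmetric] unit_exp_add[symmetric] by simp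
  also have "unit_exp (- t / 4) ^ 2 = unit_exp (- t / 2)"
    unfolding power2_eq_square unit_exp_add[symmetric] by simp
  finally show ?thesis by simp
qed

section \<open>The inversion formula for the square of eta\<close>

lemma q_product_self_nonzero:
  assumes "norm q < 1"
  shows "q_product q q \<noteq> 0"
proof -
  have "q * q ^ n \<noteq> 1" for n
    using assms power_less_one_iff[of "norm q" "Suc n"]
    by (metis norm_ge_zero norm_one norm_power order_less_irrefl power_Suc zero_less_Suc)
  thus ?thesis
    using assms by (subst q_product_eq_0_iff) auto
qed

lemma dedekind_eta_eq: "dedekind_eta t = unit_exp (t / 24) * q_product (unit_exp t) (unit_exp t)"
proof -
  have "exp (2 * of_real pi * \<i> * of_nat (Suc n) * t) = unit_exp t * unit_exp t ^ n" for n
  proof -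
    have "exp (2 * of_real pi * \<i> * of_nat (Suc n) * t) = unit_exp (of_nat (Suc n) * t)"
      by (simp only: unit_exp_def mult.assoc)
    thus ?thesis by (simp only: unit_exp_of_nat_mult power_Suc)
  qed
  thus ?thesis
    unfolding dedekind_eta_def q_product_def by (simp add: unit_exp_def)
qed

lemma dedekind_eta_nonzero: "Im t > 0 \<Longrightarrow> dedekind_eta t \<noteq> 0"
  by (simp add: dedekind_eta_eq q_product_self_nonzero)

lemma upper_half_plane_iff [simp]: "t \<in> upper_half_plane \<longleftrightarrow> Im t > 0"
  by (simp add: upper_half_plane_def)

lemma open_upper_half_plane: "open upper_half_plane"
  unfolding upper_half_plane_def by (rule open_halfspace_Im_gt)

lemma connected_upper_half_plane: "connected upper_half_plane"
  unfolding upper_half_plane_def by (intro convex_connected convex_halfspace_Im_gt)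

lemma dedekind_eta_holomorphic: "dedekind_eta holomorphic_on upper_half_plane"
  unfolding dedekind_eta_eq[abs_def]
  by (intro holomorphic_intros open_upper_half_plane) auto

lemma Im_minus_inverse_pos: "Im t > 0 \<Longrightarrow> Im (- (1 / t)) > 0"
  by (simp add: Im_divide) (metis add_pos_nonneg divide_pos_pos less_numeral_extra(3) zero_le_power2 add.commute zero_less_power)

text \<open>
  With \<open>s = -1/t\<close>, the Gaussian factor in \<open>f(z) = exp(-\<pi>iz\<^sup>2/t) theta(z/t, s)\<close> is chosen such that \<open>f\<close> has the
  quasi-periods of \<open>theta(z, t)\<close>: the roles of the periods \<open>1\<close> and \<open>t\<close> are exchanged by \<open>z \<mapsto> z/t\<close>. Comparing
  derivatives at \<open>0\<close> relates the factor \<open>C\<close> to \<open>\<eta>\<^sup>2\<close>, and comparing the products of the half-period values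
  determines \<open>C\<^sup>3\<close>. This leaves a third root of unity open.
\<close>

lemma dedekind_eta_squared_inversion_up_to_root_of_unity:
  assumes t: "Im t > 0"
  obtains D where "dedekind_eta (- (1 / t)) ^ 2 = D * t * dedekind_eta t ^ 2" and "D ^ 3 = \<i>"
proof -
  define s where "s = - (1 / t)"
  have t0: "t \<noteq> 0" using t by auto
  have s: "Im s > 0" unfolding s_def by (rule Im_minus_inverse_pos[OF t])
  have st: "s * t = - 1" using t0 by (simp add: s_def)
  define f where "f = (\<lambda>z. unit_exp (- z\<^sup>2 / (2 * t)) * theta (z / t) s)"
  have "f holomorphic_on UNIV"
    unfolding f_def
    by (intro holomorphic_intros holomorphic_on_compose_gen[OF _ theta_holomorphic[OF s], unfolded o_def, of _ _ UNIV])
       (use t0 in auto)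
  moreover have "f (z + 1) = - f z" for z
  proof -
    have "theta (z / t) s = theta ((z + 1) / t + s) s"
      using t0 by (simp add: s_def add_divide_distrib)
    also have "\<dots> = - unit_exp (- s / 2 - (z + 1) / t) * theta ((z + 1) / t) s"
      by (rule theta_add_period[OF s])
    finally have "- f z = unit_exp (- z\<^sup>2 / (2 * t) + (- s / 2 - (z + 1) / t)) * theta ((z + 1) / t) s"
      by (simp only: f_def unit_exp_add mult_minus_left mult_minus_right minus_minus mult.assoc)
    also have "- z\<^sup>2 / (2 * t) + (- s / 2 - (z + 1) / t) = - (z + 1)\<^sup>2 / (2 * t)"
      using t0 by (simp add: s_def field_simps power2_eq_square)
    finally show ?thesis by (simp add: f_def)
  qed
  moreover have "f (z + t) = - unit_exp (- t / 2 - z) * f z" for z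
  proof -
    have "theta ((z + t) / t) s = - theta (z / t) s"
      using theta_add_1[of "z / t" s] t0 by (simp add: add_divide_distrib)
    hence "f (z + t) = - (unit_exp (- (z + t)\<^sup>2 / (2 * t)) * theta (z / t) s)"
      by (simp add: f_def)
    also have "- (z + t)\<^sup>2 / (2 * t) = (- t / 2 - z) + (- z\<^sup>2 / (2 * t))"
      using t0 by (simp add: field_simps power2_eq_square)
    finally show ?thesis by (simp only: f_def unit_exp_add) simp
  qed
  moreover have "f 0 = 0" using s by (simp add: f_def)
  ultimately obtain C where C: "\<And>z. f z = C * theta z t"
    using quasi_periodic_imp_multiple_of_theta[OF t, of f] by blast

  \<comment> \<open>comparison of the derivatives at \<open>0\<close>\<close>
  have "(f has_field_derivative 2 * of_real pi * \<i> * q_product (unit_exp s) (unit_exp s) ^ 2 / t) (at 0)"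
  proof -
    have "((\<lambda>z. theta (z / t) s) has_field_derivative
        2 * of_real pi * \<i> * q_product (unit_exp s) (unit_exp s) ^ 2 * (1 / t)) (at 0)"
    proof (rule DERIV_chain2[of "\<lambda>z. theta z s"])
      show "((\<lambda>z. z / t) has_field_derivative 1 / t) (at 0)"
        using t0 by (auto intro!: derivative_eq_intros)
    qed (use theta_has_field_derivative_0[OF s] t0 in simp)
    thus ?thesis
      unfolding f_def using s t0 by (auto intro!: derivative_eq_intros)
  qed
  moreover have "(f has_field_derivative C * (2 * of_real pi * \<i> * q_product (unit_exp t) (unit_exp t) ^ 2)) (at 0)"
    unfolding C[abs_def] by (intro DERIV_cmult theta_has_field_derivative_0 t)
  ultimately have "2 * of_real pi * \<i> * q_product (unit_exp s) (unit_exp s) ^ 2 / t =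
      C * (2 * of_real pi * \<i> * q_product (unit_exp t) (unit_exp t) ^ 2)"
    by (rule DERIV_unique)
  hence phi: "q_product (unit_exp s) (unit_exp s) ^ 2 = C * t * q_product (unit_exp t) (unit_exp t) ^ 2"
    using t0 by (simp add: field_simps)

  \<comment> \<open>comparison at the half-periods, which \<open>z \<mapsto> z/t\<close> maps, up to sign and a period, to the half-periods
      of the lattice spanned by \<open>1\<close> and \<open>s\<close>\<close>
  have "f (1 / 2) * f (t / 2) * f (1 / 2 + t / 2) = - 2 * unit_exp (- 1 / 4 + (- t / 4 - s / 4))"
  proof -
    have 1: "theta (1 / 2 / t) s = - theta (s / 2) s"
    proof -
      have "1 / 2 / t = - (s / 2)" by (simp add: s_def)
      thus ?thesis using theta_minus[OF s, of "s / 2"] by metis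
    qed
    have 2: "theta (t / 2 / t) s = theta (1 / 2) s" using t0 by simp
    have "(1 / 2 + t / 2) / t = - (s / 2 + - 1 / 2)" using t0 by (simp add: s_def field_simps)
    hence "theta ((1 / 2 + t / 2) / t) s = - theta (s / 2 + - 1 / 2) s"
      using theta_minus[OF s] by metis
    also have "\<dots> = theta (s / 2 + - 1 / 2 + 1) s" by (simp only: theta_add_1)
    finally have 3: "theta ((1 / 2 + t / 2) / t) s = theta (1 / 2 + s / 2) s" by (simp add: add_ac)
    have "f (1 / 2) * f (t / 2) * f (1 / 2 + t / 2) =
      - unit_exp (- (1 / 2)\<^sup>2 / (2 * t) + - (t / 2)\<^sup>2 / (2 * t) + - (1 / 2 + t / 2)\<^sup>2 / (2 * t)) *
        (theta (1 / 2) s * theta (s / 2) s * theta (1 / 2 + s / 2) s)"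
      unfolding f_def 1 2 3 unit_exp_add by (simp only: mult_ac mult_minus_left mult_minus_right)
    also have "\<dots> = - 2 * unit_exp (- (1 / 2)\<^sup>2 / (2 * t) + - (t / 2)\<^sup>2 / (2 * t) + - (1 / 2 + t / 2)\<^sup>2 / (2 * t) + - s / 2)"
      unfolding theta_half_periods[OF s] unit_exp_add by (simp only: mult_ac mult_minus_left mult_minus_right)
    also have "- (1 / 2)\<^sup>2 / (2 * t) + - (t / 2)\<^sup>2 / (2 * t) + - (1 / 2 + t / 2)\<^sup>2 / (2 * t) + - s / 2 =
      - 1 / 4 + (- t / 4 - s / 4)"
      using t0 by (simp add: s_def field_simps power2_eq_square)
    finally show ?thesis .
  qed
  moreover have "f (1 / 2) * f (t / 2) * f (1 / 2 + t / 2) =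
      C ^ 3 * (theta (1 / 2) t * theta (t / 2) t * theta (1 / 2 + t / 2) t)"
    by (simp only: C power3_eq_cube mult_ac)
  ultimately have "C ^ 3 * (2 * unit_exp (- t / 2)) = - 2 * unit_exp (- 1 / 4 + (- t / 4 - s / 4))"
    by (simp only: theta_half_periods[OF t])
  also have "- 1 / 4 + (- t / 4 - s / 4) = - (1 / 4) + (t - s) / 4 + - t / 2"
    by (simp add: field_simps)
  finally have "C ^ 3 * (2 * unit_exp (- t / 2)) = (2 * unit_exp (- t / 2)) * (\<i> * unit_exp ((t - s) / 4))"
    unfolding unit_exp_add by (simp add: unit_exp_minus)
  hence C3: "C ^ 3 = \<i> * unit_exp ((t - s) / 4)"
    by simp

  \<comment> \<open>the exponential accounts for the factors \<open>q\<^bsup>1/12\<^esup>\<close> of \<open>\<eta>\<^sup>2\<close> at \<open>s\<close> and \<open>t\<close>\<close>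
  define D where "D = C * unit_exp ((s - t) / 12)"
  have "D ^ 3 = C ^ 3 * unit_exp (of_nat 3 * ((s - t) / 12))"
    by (simp only: D_def power_mult_distrib unit_exp_of_nat_mult)
  also have "of_nat 3 * ((s - t) / 12) = - ((t - s) / 4)" by (simp add: field_simps)
  finally have "D ^ 3 = \<i>" by (simp add: C3 unit_exp_minus)
  moreover have "dedekind_eta s ^ 2 = D * t * dedekind_eta t ^ 2"
  proof -
    have sq: "unit_exp (w / 24) ^ 2 = unit_exp (w / 12)" for w
      unfolding power2_eq_square unit_exp_add[symmetric] by simp
    have "unit_exp (s / 12) = unit_exp ((s - t) / 12) * unit_exp (t / 12)"
      unfolding unit_exp_add[symmetric] by (simp add: diff_divide_distrib)
    thus ?thesis
      by (simp add: dedekind_eta_eq power_mult_distrib sq phi D_def)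
  qed
  ultimately show ?thesis using that unfolding s_def by blast
qed

text \<open>
  The quotient of \<open>\<eta>\<^sup>2(-1/t)\<close> by \<open>t\<eta>\<^sup>2(t)\<close> is continuous with values among the three cube roots of \<open>i\<close>, so it
  is constant. At the fixed point \<open>t = i\<close> of the inversion the values of \<open>\<eta>\<close> cancel.
\<close>

theorem dedekind_eta_squared_inversion:
  assumes t: "Im t > 0"
  shows "dedekind_eta (- (1 / t)) ^ 2 = - \<i> * t * dedekind_eta t ^ 2"
proof -
  define D where "D = (\<lambda>t. dedekind_eta (- (1 / t)) ^ 2 / (t * dedekind_eta t ^ 2))"
  have D3: "D t ^ 3 = \<i>" if "Im t > 0" for t
  proof -
    from that have "t * dedekind_eta t ^ 2 \<noteq> 0"
      using dedekind_eta_nonzero by auto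
    thus ?thesis
      using dedekind_eta_squared_inversion_up_to_root_of_unity[OF that]
      by (metis (no_types, lifting) D_def mult.assoc nonzero_mult_div_cancel_right)
  qed
  have "finite (D ` upper_half_plane)"
  proof (rule finite_subset)
    show "D ` upper_half_plane \<subseteq> {z. z ^ 3 = \<i>}"
      using D3 by auto
    show "finite {z::complex. z ^ 3 = \<i>}"
      by (rule finite_nth_roots) auto
  qed
  moreover have "D holomorphic_on upper_half_plane"
  proof -
    have "(\<lambda>t. dedekind_eta (- (1 / t))) holomorphic_on upper_half_plane"
    proof (rule holomorphic_on_compose_gen[OF _ dedekind_eta_holomorphic, unfolded o_def])
      show "(\<lambda>t. - (1 / t)) ` upper_half_plane \<subseteq> upper_half_plane"
        by (intro image_subsetI) (simp only: upper_half_plane_iff Im_minus_inverse_pos)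
    qed (auto intro!: holomorphic_intros)
    thus ?thesis
      unfolding D_def
      by (intro holomorphic_intros dedekind_eta_holomorphic)
         (auto dest: dedekind_eta_nonzero)
  qed
  ultimately obtain c where c: "\<And>t. Im t > 0 \<Longrightarrow> D t = c"
    using continuous_finite_range_constant[OF connected_upper_half_plane, of D]
    by (auto simp: constant_on_def holomorphic_on_imp_continuous_on)
  have "- (1 / \<i>) = \<i>" by (simp add: field_simps)
  hence "D \<i> = - \<i>"
    using dedekind_eta_nonzero[of \<i>] by (simp add: D_def)
  hence "D t = - \<i>" using c[of \<i>] c[OF t] by simp
  moreover have "t * dedekind_eta t ^ 2 \<noteq> 0"
    using t dedekind_eta_nonzero by auto
  ultimately show ?thesis
    unfolding D_def by (simp add: field_simps)
qed

section \<open>The multiplier of the square of eta\<close>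

text \<open>
  The multiplier of \<open>\<eta>\<^sup>2\<close> at a matrix with rows \<open>(a, b)\<close> and \<open>(c, d)\<close> is \<open>exp(2\<pi>i/12)\<close> to this power: a
  polynomial form of the isomorphism from the abelianization of the modular group to \<open>\<int>/12\<close>. Being a
  polynomial with integer coefficients, it visibly depends only on the entries modulo \<open>m\<close> when it is itself
  read modulo \<open>m\<close>.
\<close>

definition eta_exponent :: "int \<Rightarrow> int \<Rightarrow> int \<Rightarrow> int \<Rightarrow> int" where
  "eta_exponent a b c d = (1 - c\<^sup>2) * (b * d + 3 * (c - 1) * d + c + 3) + c * (a + d - 3)"

text \<open>
  The defect is, up to sign, \<open>n(1 - c\<^sup>2)(1 - d\<^sup>2)\<close>. It is divisible by \<open>12\<close>, as neither \<open>2\<close> nor \<open>3\<close> divides both \<open>c\<close> and \<open>d\<close>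
  and \<open>1 - x\<^sup>2\<close> is divisible by \<open>4\<close> for odd \<open>x\<close> and by \<open>3\<close> for \<open>x\<close> prime to \<open>3\<close>.
\<close>

lemma eta_exponent_translate:
  assumes "a * d - b * c = 1"
  shows "[eta_exponent (a + n * c) (b + n * d) c d = eta_exponent a b c d + n] (mod 12)"
proof -
  have "eta_exponent (a + n * c) (b + n * d) c d - (eta_exponent a b c d + n) = - (n * ((1 - c\<^sup>2) * (1 - d\<^sup>2)))"
    by (simp add: eta_exponent_def algebra_simps power2_eq_square)
  moreover have "12 dvd (1 - c\<^sup>2) * (1 - d\<^sup>2)"
  proof -
    have sq: "1 - x\<^sup>2 = - ((x - 1) * (x + 1))" for x :: int
      by (simp add: algebra_simps power2_eq_square)
    have sq3: "3 dvd x \<or> 3 dvd 1 - x\<^sup>2" for x :: int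
    proof -
      have "3 dvd x \<or> 3 dvd x - 1 \<or> 3 dvd x + 1" by presburger
      thus ?thesis unfolding sq by auto
    qed
    have sq4: "even x \<or> 4 dvd 1 - x\<^sup>2" for x :: int
      unfolding sq using mult_dvd_mono[of 2 "x - 1" 2 "x + 1"] by auto
    have cop: "\<not> (p dvd c \<and> p dvd d)" if "p > 1" for p :: int
    proof
      assume "p dvd c \<and> p dvd d"
      hence "p dvd a * d - b * c" by simp
      thus False using assms that by auto
    qed
    have "3 dvd (1 - c\<^sup>2) * (1 - d\<^sup>2)"
      using sq3[of c] sq3[of d] cop[of 3] by auto
    moreover have "4 dvd (1 - c\<^sup>2) * (1 - d\<^sup>2)"
      using sq4[of c] sq4[of d] cop[of 2] by auto
    ultimately show ?thesis by presburger
  qed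
  ultimately show ?thesis
    unfolding cong_iff_dvd_diff by (metis dvd_minus_iff dvd_mult)
qed

text \<open>
  Both sides are polynomials in the entries, so the congruence is a finite check over the residues modulo
  \<open>3\<close> and modulo \<open>4\<close>.
\<close>

lemma eta_exponent_inversion:
  assumes "a * d - b * c = 1"
  shows "[eta_exponent (- c) (- d) a b = eta_exponent a b c d - 3] (mod 12)"
proof -
  define E where "E = (\<lambda>a b c d. eta_exponent (- c) (- d) a b - (eta_exponent a b c d - 3))"
  have dvd: "m dvd E a b c d"
    if "\<forall>a\<in>R. \<forall>b\<in>R. \<forall>c\<in>R. \<forall>d\<in>R. (a * d - b * c) mod m = 1 \<longrightarrow> E a b c d mod m = 0"
      and m: "m > 1" "R = {0..<m}" for m R
  proof -
    have "[a mod m * (d mod m) - b mod m * (c mod m) = a * d - b * c] (mod m)"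
      by (intro cong_diff cong_mult) (simp_all add: cong_def)
    hence "(a mod m * (d mod m) - b mod m * (c mod m)) mod m = (a * d - b * c) mod m"
      by (simp add: cong_def)
    also have "\<dots> = 1" using assms m by simp
    finally have "E (a mod m) (b mod m) (c mod m) (d mod m) mod m = 0"
      using that by auto
    moreover have md: "[x mod m = x] (mod m)" for x
      by (simp add: cong_def)
    have "[E (a mod m) (b mod m) (c mod m) (d mod m) = E a b c d] (mod m)"
      unfolding E_def eta_exponent_def
      by (intro cong_add cong_diff cong_mult cong_pow cong_minus_minus_iff[THEN iffD2] md cong_refl)
    ultimately show ?thesis by (simp only: cong_def dvd_eq_mod_eq_0)
  qed
  have "3 dvd E a b c d"
  proof (rule dvd)
    show "\<forall>a\<in>{0, 1, 2}. \<forall>b\<in>{0, 1, 2}. \<forall>c\<in>{0, 1, 2}. \<forall>d\<in>{0, 1, 2}.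
        (a * d - b * c) mod 3 = 1 \<longrightarrow> E a b c d mod 3 = 0"
      unfolding E_def eta_exponent_def by code_simp
  qed auto
  moreover have "4 dvd E a b c d"
  proof (rule dvd)
    show "\<forall>a\<in>{0, 1, 2, 3}. \<forall>b\<in>{0, 1, 2, 3}. \<forall>c\<in>{0, 1, 2, 3}. \<forall>d\<in>{0, 1, 2, 3}.
        (a * d - b * c) mod 4 = 1 \<longrightarrow> E a b c d mod 4 = 0"
      unfolding E_def eta_exponent_def by code_simp
  qed auto
  ultimately have "12 dvd E a b c d" by presburger
  thus ?thesis by (simp add: cong_iff_dvd_diff E_def)
qed

lemma unit_exp_cong:
  assumes "[m = n] (mod int N)" "N > 0"
  shows "unit_exp (of_int m / of_nat N) = unit_exp (of_int n / of_nat N)"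
proof -
  obtain k where "m - n = int N * k" using assms(1) by (auto simp: cong_iff_dvd_diff)
  hence "m = n + int N * k" by simp
  hence "of_int m / of_nat N = of_int n / of_nat N + (of_int k :: complex)"
    using assms(2) by (simp add: field_simps)
  thus ?thesis by (simp add: unit_exp_add)
qed

lemma dedekind_eta_squared_translation:
  "dedekind_eta (t + of_int n) ^ 2 = unit_exp (of_int n / 12) * dedekind_eta t ^ 2"
proof -
  have "unit_exp ((t + of_int n) / 24) ^ 2 = unit_exp (of_int n / 12) * unit_exp (t / 24) ^ 2"
    unfolding power2_eq_square unit_exp_add[symmetric]
    by (rule arg_cong[of _ _ unit_exp]) (simp add: field_simps)
  thus ?thesis
    by (simp add: dedekind_eta_eq power_mult_distrib unit_exp_add)
qed

lemma Im_fractional_linear: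
  fixes a b c d :: int
  assumes "a * d - b * c = 1"
  shows "Im ((of_int a * t + of_int b) / (of_int c * t + of_int d)) = Im t / norm (of_int c * t + of_int d) ^ 2"
proof -
  have "real_of_int a * real_of_int d - real_of_int b * real_of_int c = 1"
    using assms by (metis of_int_1 of_int_diff of_int_mult)
  hence "(of_int a * d - of_int b * c) * Im t = Im t" by simp
  thus ?thesis
    by (simp add: Im_divide cmod_power2 algebra_simps)
qed

lemma fractional_linear_denominator_nonzero:
  fixes a b c d :: int
  assumes "a * d - b * c = 1" "Im t > 0"
  shows "of_int c * t + of_int d \<noteq> 0"
proof
  assume *: "of_int c * t + of_int d = 0"
  hence "Im (of_int c * t + of_int d) = 0" by simp
  hence "c = 0" using assms(2) by simp
  with * have "d = 0" by simp
  with \<open>c = 0\<close> assms(1) show False by simp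
qed

text \<open>
  Induction along the Euclidean algorithm for \<open>a\<close> and \<open>c\<close>: a translation replaces \<open>a\<close> by \<open>a mod c\<close>, the
  inversion then moves this remainder into the lower left corner. The lemmas on \<open>eta_exponent\<close> say that
  the claimed multiplier changes in these steps as \<open>\<eta>\<^sup>2\<close> does.
\<close>

lemma dedekind_eta_squared_fractional_linear:
  fixes a b c d :: int
  assumes "a * d - b * c = 1" "Im t > 0"
  shows "dedekind_eta ((of_int a * t + of_int b) / (of_int c * t + of_int d)) ^ 2 =
    unit_exp (of_int (eta_exponent a b c d) / 12) * (of_int c * t + of_int d) * dedekind_eta t ^ 2"
  using assms(1)
proof (induction "nat \<bar>c\<bar>" arbitrary: a b c d rule: less_induct)
  case less
  show ?case
  proof (cases "c = 0")
    case True
    with less.prems have "a * d = 1" by simp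
    hence "(a = 1 \<and> d = 1) \<or> (a = -1 \<and> d = -1)" by (metis zmult_eq_1_iff)
    thus ?thesis
    proof (elim disjE conjE)
      assume "a = 1" "d = 1"
      thus ?thesis using dedekind_eta_squared_translation[of t b]
        by (simp add: True eta_exponent_def)
    next
      assume ad: "a = -1" "d = -1"
      have "of_int (6 - b) / 12 = 1 / 2 + of_int (- b) / (12 :: complex)"
        by (simp add: field_simps)
      hence "unit_exp (of_int (6 - b) / 12) = - unit_exp (of_int (- b) / 12)"
        by (simp only: unit_exp_add unit_exp_half) simp
      thus ?thesis using dedekind_eta_squared_translation[of t "- b"] ad
        by (simp add: True eta_exponent_def)
    qed
  next
    case False
    define n where "n = a div c"
    define a' where "a' = a mod c"
    define b' where "b' = b - n * d"
    have a: "a = a' + n * c" by (simp add: a'_def n_def)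
    have b: "b = b' + n * d" by (simp add: b'_def)
    have det: "a' * d - b' * c = 1" using less.prems unfolding a b by (simp add: algebra_simps)
    have det': "(- c) * b' - (- d) * a' = 1" using det by (simp add: algebra_simps)
    have small: "nat \<bar>a'\<bar> < nat \<bar>c\<bar>" using abs_mod_less[OF False, of a] unfolding a'_def by linarith
    \<comment> \<open>the inverse image under \<open>w \<mapsto> -1/w + n\<close> of the point at which \<open>\<eta>\<close> is to be evaluated\<close>
    define w where "w = (of_int (- c) * t + of_int (- d)) / (of_int a' * t + of_int b')"
    have den0: "of_int a' * t + of_int b' \<noteq> 0" "of_int c * t + of_int d \<noteq> 0"
      using fractional_linear_denominator_nonzero[OF det' assms(2)]
        fractional_linear_denominator_nonzero[OF det assms(2)] by auto
    have "Im w > 0"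
      unfolding w_def Im_fractional_linear[OF det'] using den0 assms(2) by simp
    have num: "of_int a * t + of_int b = (of_int a' * t + of_int b') + of_int n * (of_int c * t + of_int d)"
      by (simp add: a b algebra_simps)
    have "(of_int a * t + of_int b) / (of_int c * t + of_int d) = - (1 / w) + of_int n"
    proof -
      define X Y where "X = of_int a' * t + of_int b'" and "Y = of_int c * t + of_int d"
      have "w = - Y / X" by (simp add: w_def X_def Y_def)
      hence "1 / w = - (X / Y)" by simp
      moreover have "Y \<noteq> 0" using den0 by (simp add: Y_def)
      ultimately have "(X + of_int n * Y) / Y = - (1 / w) + of_int n"
        by (simp add: field_simps)
      thus ?thesis by (simp only: num X_def Y_def)
    qed
    hence "dedekind_eta ((of_int a * t + of_int b) / (of_int c * t + of_int d)) ^ 2 =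
        unit_exp (of_int n / 12) * (- \<i> * w * dedekind_eta w ^ 2)"
      using dedekind_eta_squared_inversion[OF \<open>Im w > 0\<close>]
      by (simp only: dedekind_eta_squared_translation)
    also have "dedekind_eta w ^ 2 = unit_exp (of_int (eta_exponent (- c) (- d) a' b') / 12) *
        (of_int a' * t + of_int b') * dedekind_eta t ^ 2"
      unfolding w_def by (rule less.hyps[OF small det'])
    also have "unit_exp (of_int (eta_exponent (- c) (- d) a' b') / 12) =
        unit_exp (of_int (eta_exponent a' b' c d - 3) / 12)"
      using unit_exp_cong[of _ _ 12] eta_exponent_inversion[OF det] by simp
    also have "\<dots> = - \<i> * unit_exp (of_int (eta_exponent a' b' c d) / 12)"
      by (simp add: diff_divide_distrib unit_exp_diff)
    also have "unit_exp (of_int n / 12) * (- \<i> * w * (- \<i> * unit_exp (of_int (eta_exponent a' b' c d) / 12) *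
        (of_int a' * t + of_int b') * dedekind_eta t ^ 2)) =
      unit_exp (of_int n / 12) * unit_exp (of_int (eta_exponent a' b' c d) / 12) *
        (- (w * (of_int a' * t + of_int b'))) * dedekind_eta t ^ 2"
      by (simp add: algebra_simps)
    also have "- (w * (of_int a' * t + of_int b')) = of_int c * t + of_int d"
      using den0 by (simp add: w_def)
    also have "unit_exp (of_int n / 12) * unit_exp (of_int (eta_exponent a' b' c d) / 12) =
        unit_exp (of_int (eta_exponent a' b' c d + n) / 12)"
      by (simp add: unit_exp_add add_divide_distrib)
    also have "\<dots> = unit_exp (of_int (eta_exponent a b c d) / 12)"
      using unit_exp_cong[of _ _ 12] eta_exponent_translate[OF det, of n] by (simp add: a b cong_sym_eq)
    finally show ?thesis .
  qed
qed

section \<open>The modular group and the slash operator\<close>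

definition cocycle :: "int ^ 2 ^ 2 \<Rightarrow> complex \<Rightarrow> complex" where
  "cocycle A t = of_int (A $ 2 $ 1) * t + of_int (A $ 2 $ 2)"

lemma slash_eq: "slash k f A t = f (moebius A t) / cocycle A t ^ k"
  by (simp add: slash_def cocycle_def)

lemma moebius_eq: "moebius A t = (of_int (A $ 1 $ 1) * t + of_int (A $ 1 $ 2)) / cocycle A t"
  by (simp add: moebius_def cocycle_def)

lemma SL2Z_iff: "A \<in> SL2Z \<longleftrightarrow> A $ 1 $ 1 * A $ 2 $ 2 - A $ 1 $ 2 * A $ 2 $ 1 = 1"
  by (simp add: SL2Z_def det_2)

lemma matrix_mult_2: "(A ** B) $ i $ j = A $ i $ 1 * B $ 1 $ j + A $ i $ 2 * B $ 2 $ j"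
  for A B :: "int ^ 2 ^ 2"
  by (simp add: matrix_matrix_mult_def sum_2)

lemma matrix_eq_2: "A = B \<longleftrightarrow> A $ 1 $ 1 = B $ 1 $ 1 \<and> A $ 1 $ 2 = B $ 1 $ 2 \<and>
    A $ 2 $ 1 = B $ 2 $ 1 \<and> A $ 2 $ 2 = B $ 2 $ 2"
  for A B :: "int ^ 2 ^ 2"
  by (auto simp: vec_eq_iff forall_2)

lemma mat_1_2: "(mat 1 :: int ^ 2 ^ 2) $ 1 $ 1 = 1" "(mat 1 :: int ^ 2 ^ 2) $ 1 $ 2 = 0"
   "(mat 1 :: int ^ 2 ^ 2) $ 2 $ 1 = 0" "(mat 1 :: int ^ 2 ^ 2) $ 2 $ 2 = 1"
  by (simp_all add: mat_def)

lemma SL2Z_mult: "A \<in> SL2Z \<Longrightarrow> B \<in> SL2Z \<Longrightarrow> A ** B \<in> SL2Z"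
  by (simp add: SL2Z_def det_mul)

lemma SL2Z_mat_1: "mat 1 \<in> SL2Z"
  by (simp add: SL2Z_def)

lemma SL2Z_inverse:
  assumes "A \<in> SL2Z"
  obtains B where "B \<in> SL2Z" "A ** B = mat 1" "B ** A = mat 1"
proof -
  define B :: "int ^ 2 ^ 2" where
    "B = vector [vector [A $ 2 $ 2, - A $ 1 $ 2], vector [- A $ 2 $ 1, A $ 1 $ 1]]"
  have B: "B $ 1 $ 1 = A $ 2 $ 2" "B $ 1 $ 2 = - A $ 1 $ 2" "B $ 2 $ 1 = - A $ 2 $ 1" "B $ 2 $ 2 = A $ 1 $ 1"
    by (simp_all add: B_def)
  show ?thesis
    using assms by (intro that[of B])
      (simp_all add: SL2Z_iff matrix_eq_2 matrix_mult_2 B mat_1_2 algebra_simps)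
qed

lemma cocycle_nonzero: "A \<in> SL2Z \<Longrightarrow> Im t > 0 \<Longrightarrow> cocycle A t \<noteq> 0"
  unfolding cocycle_def SL2Z_iff by (rule fractional_linear_denominator_nonzero)

lemma Im_moebius: "A \<in> SL2Z \<Longrightarrow> Im (moebius A t) = Im t / norm (cocycle A t) ^ 2"
  unfolding moebius_eq cocycle_def SL2Z_iff by (rule Im_fractional_linear)

lemma Im_moebius_pos: "A \<in> SL2Z \<Longrightarrow> Im t > 0 \<Longrightarrow> Im (moebius A t) > 0"
  using cocycle_nonzero by (simp add: Im_moebius)

lemma moebius_mat_1 [simp]: "moebius (mat 1) t = t"
  by (simp add: moebius_def mat_1_2)

lemma cocycle_mat_1 [simp]: "cocycle (mat 1) t = 1"
  by (simp add: cocycle_def mat_1_2)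

lemma cocycle_mult:
  assumes "B \<in> SL2Z" "Im t > 0"
  shows "cocycle (A ** B) t = cocycle A (moebius B t) * cocycle B t"
proof -
  have "cocycle A (moebius B t) * cocycle B t =
      of_int (A $ 2 $ 1) * (moebius B t * cocycle B t) + of_int (A $ 2 $ 2) * cocycle B t"
    by (simp add: cocycle_def algebra_simps)
  also have "moebius B t * cocycle B t = of_int (B $ 1 $ 1) * t + of_int (B $ 1 $ 2)"
    using cocycle_nonzero[OF assms] by (simp add: moebius_eq)
  finally show ?thesis by (simp add: cocycle_def matrix_mult_2 algebra_simps)
qed

lemma moebius_mult:
  assumes "A \<in> SL2Z" "B \<in> SL2Z" "Im t > 0"
  shows "moebius (A ** B) t = moebius A (moebius B t)"
proof -
  have nz: "cocycle B t \<noteq> 0" by (rule cocycle_nonzero[OF assms(2,3)])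
  define z where "z = moebius B t"
  have num: "of_int (B $ 1 $ 1) * t + of_int (B $ 1 $ 2) = z * cocycle B t"
    using nz by (simp add: moebius_eq z_def)
  have "of_int ((A ** B) $ 1 $ 1) * t + of_int ((A ** B) $ 1 $ 2) =
      of_int (A $ 1 $ 1) * (of_int (B $ 1 $ 1) * t + of_int (B $ 1 $ 2)) + of_int (A $ 1 $ 2) * cocycle B t"
    by (simp add: cocycle_def matrix_mult_2 algebra_simps)
  also have "\<dots> = (of_int (A $ 1 $ 1) * z + of_int (A $ 1 $ 2)) * cocycle B t"
    unfolding num by (simp add: algebra_simps)
  finally show ?thesis
    using nz unfolding moebius_eq[of "A ** B"] cocycle_mult[OF assms(2,3)] z_def[symmetric]
    by (simp add: moebius_eq)
qed

lemma slash_slash: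
  assumes "A \<in> SL2Z" "B \<in> SL2Z" "Im t > 0"
  shows "slash k f (A ** B) t = slash k f A (moebius B t) / cocycle B t ^ k"
  by (simp add: slash_eq moebius_mult[OF assms] cocycle_mult[OF assms(2,3)] power_mult_distrib)

lemma slash_mult: "slash (k + l) (\<lambda>t. f t * g t) A t = slash k f A t * slash l g A t"
  by (simp add: slash_eq power_add)

text \<open>
  If \<open>A\<close> and \<open>B\<close> agree modulo \<open>N\<close>, then \<open>A B\<^sup>-\<^sup>1\<close> lies in \<open>\<Gamma>(N)\<close>. Consequently a modular form has only finitely
  many slash transforms, which makes bounds uniform over the full modular group.
\<close>

lemma slash_cong_mod:
  assumes inv: "\<And>C t. C \<in> principal_congruence_subgroup N \<Longrightarrow> Im t > 0 \<Longrightarrow> slash k f C t = f t"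
    and AB: "A \<in> SL2Z" "B \<in> SL2Z" and cong: "\<And>i j. [A $ i $ j = B $ i $ j] (mod int N)"
    and t: "Im t > 0"
  shows "slash k f A t = slash k f B t"
proof -
  obtain B' where B': "B' \<in> SL2Z" "B ** B' = mat 1" "B' ** B = mat 1"
    by (rule SL2Z_inverse[OF AB(2)])
  have "[(A ** B') $ i $ j = (B ** B') $ i $ j] (mod int N)" for i j
    unfolding matrix_mult_2 by (intro cong_add cong_mult cong cong_refl)
  hence "A ** B' \<in> principal_congruence_subgroup N"
    using SL2Z_mult[OF AB(1) B'(1)] by (simp add: principal_congruence_subgroup_def B')
  note G = inv[OF this Im_moebius_pos[OF AB(2) t]]
  have "A = (A ** B') ** B" by (simp add: matrix_mul_assoc[symmetric] B')
  hence "slash k f A t = slash k f (A ** B') (moebius B t) / cocycle B t ^ k"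
    using slash_slash[OF SL2Z_mult[OF AB(1) B'(1)] AB(2) t] by metis
  thus ?thesis unfolding G by (simp add: slash_eq)
qed

text \<open>
  If \<open>|Re t| \<le> 1/2\<close> and \<open>Im t < 1/2\<close>, then \<open>|t|\<^sup>2 \<le> 1/2\<close>, and the inversion at least doubles the imaginary
  part. After a translation this applies to every point, so finitely many steps reach height \<open>1/2\<close>; the
  exponent \<open>n\<close> bounds their number.
\<close>

lemma exists_SL2Z_Im_moebius_ge_half:
  assumes "Im t > 0"
  obtains B where "B \<in> SL2Z" "Im (moebius B t) \<ge> 1 / 2"
proof -
  have "\<exists>B\<in>SL2Z. Im (moebius B t) \<ge> 1 / 2" if "Im t > 0" "2 ^ n * Im t \<ge> 1 / 2" for n
    using that
  proof (induction n arbitrary: t)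
    case 0
    thus ?case using SL2Z_mat_1 by (intro bexI[of _ "mat 1"]) auto
  next
    case (Suc n)
    show ?case
    proof (cases "Im t \<ge> 1 / 2")
      case True
      thus ?thesis using SL2Z_mat_1 by (intro bexI[of _ "mat 1"]) auto
    next
      case False
      define m where "m = - \<lfloor>Re t + 1 / 2\<rfloor>"
      define M :: "int ^ 2 ^ 2" where "M = vector [vector [0, - 1], vector [1, m]]"
      have M: "M \<in> SL2Z" "cocycle M t = t + of_int m"
        by (simp_all add: M_def SL2Z_iff cocycle_def)
      have "\<bar>Re t + of_int m\<bar> \<le> 1 / 2" unfolding m_def by linarith
      hence "(Re t + of_int m)\<^sup>2 \<le> (1 / 2)\<^sup>2" by (metis abs_ge_zero power2_abs power_mono)
      moreover have "(Im t)\<^sup>2 \<le> (1 / 2)\<^sup>2" using False Suc.prems by (intro power_mono) auto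
      ultimately have "norm (cocycle M t) ^ 2 \<le> 1 / 2"
        unfolding M cmod_power2 by (simp add: power2_eq_square)
      moreover have pos: "norm (cocycle M t) ^ 2 > 0"
        using cocycle_nonzero[OF M(1) Suc.prems(1)] by simp
      ultimately have "Im t / (1 / 2) \<le> Im t / norm (cocycle M t) ^ 2"
        using Suc.prems(1) by (intro divide_left_mono) auto
      hence "2 * Im t \<le> Im (moebius M t)"
        by (simp add: Im_moebius[OF M(1)])
      hence "2 ^ n * (2 * Im t) \<le> 2 ^ n * Im (moebius M t)"
        by (intro mult_left_mono) auto
      moreover have "1 / 2 \<le> 2 ^ n * (2 * Im t)" using Suc.prems(2) by (simp add: mult_ac)
      ultimately have "1 / 2 \<le> 2 ^ n * Im (moebius M t)" by (rule order_trans[rotated])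
      from Suc.IH[OF Im_moebius_pos[OF M(1) Suc.prems(1)] this]
      obtain B where B: "B \<in> SL2Z" "Im (moebius B (moebius M t)) \<ge> 1 / 2" by blast
      thus ?thesis
        using M Suc.prems(1) by (intro bexI[of _ "B ** M"]) (simp_all add: moebius_mult SL2Z_mult)
    qed
  qed
  moreover obtain n where "1 / 2 / Im t < 2 ^ n"
    using real_arch_pow[of 2 "1 / 2 / Im t"] by auto
  hence "2 ^ n * Im t \<ge> 1 / 2" using assms by (simp add: field_simps)
  ultimately show ?thesis using that assms by blast
qed

section \<open>Holomorphy in the local parameter at the cusps\<close>

text \<open>
  An expansion in powers of \<open>q\<^bsup>1/N\<^esup>\<close> is the same as a holomorphic function \<open>h\<close> of the local parameter on the
  whole unit disc. Products and quotients are far easier to form for \<open>h\<close> than for coefficient sequences.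
\<close>

definition q_lift :: "nat \<Rightarrow> (complex \<Rightarrow> complex) \<Rightarrow> (complex \<Rightarrow> complex) \<Rightarrow> bool" where
  "q_lift N g h \<longleftrightarrow> h holomorphic_on ball 0 1 \<and> (\<forall>t. Im t > 0 \<longrightarrow> g t = h (unit_exp (t / of_nat N)))"

lemma unit_exp_surj_punctured_disc:
  assumes "N > 0" "x \<noteq> 0" "norm x < 1"
  obtains t where "Im t > 0" "unit_exp (t / of_nat N) = x"
proof -
  define t where "t = of_nat N * (Ln x / (2 * of_real pi * \<i>))"
  have u: "unit_exp (t / of_nat N) = x"
    using assms by (simp add: unit_exp_def t_def)
  have "Im (t / of_nat N) > 0"
    using assms(3) unfolding u[symmetric] norm_unit_exp_less_1_iff .
  hence "Im t > 0"
    using assms(1) by (simp add: zero_less_divide_iff)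
  thus ?thesis using u that by blast
qed

lemma q_expansion_iff_q_lift:
  assumes "N > 0"
  shows "(\<exists>a. has_q_expansion N g a \<and> P (a 0)) \<longleftrightarrow> (\<exists>h. q_lift N g h \<and> P (h 0))"
proof -
  have ex: "exp (2 * of_real pi * \<i> * of_nat n * t / of_nat N) = unit_exp (t / of_nat N) ^ n" for n t
    by (simp add: unit_exp_def exp_of_nat_mult[symmetric] mult_ac)
  show ?thesis
  proof safe
    fix a assume a: "has_q_expansion N g a" and P: "P (a 0)"
    define h where "h = (\<lambda>x. \<Sum>n. a n * x ^ n)"
    have sums: "(\<lambda>n. a n * unit_exp (t / of_nat N) ^ n) sums g t" if "Im t > 0" for t
      using a that unfolding has_q_expansion_def ex by simp
    have sums_h: "(\<lambda>n. a n * x ^ n) sums h x" if x: "norm x < 1" for x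
    proof (cases "x = 0")
      case False
      then obtain t where "Im t > 0" "unit_exp (t / of_nat N) = x"
        using unit_exp_surj_punctured_disc[OF assms False x] by blast
      thus ?thesis using sums[of t] by (auto simp: h_def sums_iff)
    qed (simp add: h_def powser_sums_zero summable_sums powser_sums_zero_iff)
    have "h holomorphic_on ball 0 1"
      using sums_h by (intro power_series_holomorphic[of _ _ a]) simp
    moreover have "g t = h (unit_exp (t / of_nat N))" if "Im t > 0" for t
      using sums[OF that] by (simp add: h_def sums_iff)
    moreover have "h 0 = a 0" by (simp add: h_def)
    ultimately show "\<exists>h. q_lift N g h \<and> P (h 0)"
      using P by (auto simp: q_lift_def)
  next
    fix h assume h: "q_lift N g h" and P: "P (h 0)"
    define a where "a = (\<lambda>n. (deriv ^^ n) h 0 / fact n)"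
    have "has_q_expansion N g a"
      unfolding has_q_expansion_def ex
    proof
      fix t assume "t \<in> upper_half_plane"
      hence "unit_exp (t / of_nat N) \<in> ball 0 1" "g t = h (unit_exp (t / of_nat N))"
        using h assms by (simp_all add: q_lift_def zero_less_divide_iff)
      thus "(\<lambda>n. a n * unit_exp (t / of_nat N) ^ n) sums g t"
        using holomorphic_power_series[of h 0 1 "unit_exp (t / of_nat N)"] h
        by (simp add: a_def q_lift_def)
    qed
    moreover have "a 0 = h 0" by (simp add: a_def)
    ultimately show "\<exists>a. has_q_expansion N g a \<and> P (a 0)" using P by metis
  qed
qed

text \<open>
  Modular forms whose constant term at every cusp satisfies \<open>P\<close>. The trivial predicate gives all modular
  forms and \<open>\<lambda>x. x = 0\<close> the cusp forms, so that closure properties have to be proved only once.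
\<close>

definition forms :: "(complex \<Rightarrow> bool) \<Rightarrow> nat \<Rightarrow> nat \<Rightarrow> (complex \<Rightarrow> complex) set" where
  "forms P N k =
     {f. f holomorphic_on upper_half_plane \<and>
         (\<forall>t. t \<notin> upper_half_plane \<longrightarrow> f t = 0) \<and>
         (\<forall>A\<in>principal_congruence_subgroup N. \<forall>t\<in>upper_half_plane. slash k f A t = f t) \<and>
         (\<forall>A\<in>SL2Z. \<exists>h. q_lift N (slash k f A) h \<and> P (h 0))}"

lemma modular_forms_eq: "N > 0 \<Longrightarrow> modular_forms N k = forms (\<lambda>_. True) N k"
  using q_expansion_iff_q_lift[of N _ "\<lambda>_. True"] by (simp add: modular_forms_def forms_def)

lemma cusp_forms_eq:
  assumes "N > 0"
  shows "cusp_forms N k = forms (\<lambda>x. x = 0) N k"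
proof -
  have "(\<exists>h. q_lift N g h \<and> h 0 = 0) \<Longrightarrow> (\<exists>h. q_lift N g h)" for g by blast
  thus ?thesis
    unfolding cusp_forms_def modular_forms_eq[OF assms]
      q_expansion_iff_q_lift[OF assms, of _ "\<lambda>x. x = 0"]
    by (auto simp: forms_def)
qed

lemma forms_mono: "(\<And>x. P x \<Longrightarrow> Q x) \<Longrightarrow> forms P N k \<subseteq> forms Q N k"
  unfolding forms_def by blast

lemma forms_add:
  assumes "f \<in> forms P N k" "g \<in> forms P N k" and P: "\<And>x y. P x \<Longrightarrow> P y \<Longrightarrow> P (x + y)"
  shows "(\<lambda>t. f t + g t) \<in> forms P N k"
proof -
  have sl: "slash k (\<lambda>t. f t + g t) A t = slash k f A t + slash k g A t" for A t
    by (simp add: slash_eq add_divide_distrib)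
  have "\<exists>h. q_lift N (slash k (\<lambda>t. f t + g t) A) h \<and> P (h 0)" if A: "A \<in> SL2Z" for A
  proof -
    from assms A obtain h1 h2 where h: "q_lift N (slash k f A) h1" "P (h1 0)"
      "q_lift N (slash k g A) h2" "P (h2 0)" unfolding forms_def by blast
    show ?thesis
      using h P by (intro exI[of _ "\<lambda>x. h1 x + h2 x"]) (auto simp: q_lift_def sl intro!: holomorphic_intros)
  qed
  thus ?thesis
    using assms by (auto simp: forms_def sl intro!: holomorphic_intros)
qed

lemma forms_mult:
  assumes "f \<in> forms P N k" "g \<in> forms Q N l" and R: "\<And>x y. P x \<Longrightarrow> Q y \<Longrightarrow> R (x * y)"
  shows "(\<lambda>t. f t * g t) \<in> forms R N (k + l)"
proof -
  have "\<exists>h. q_lift N (slash (k + l) (\<lambda>t. f t * g t) A) h \<and> R (h 0)" if A: "A \<in> SL2Z" for A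
  proof -
    from assms A obtain h1 h2 where h: "q_lift N (slash k f A) h1" "P (h1 0)"
      "q_lift N (slash l g A) h2" "Q (h2 0)" unfolding forms_def by blast
    show ?thesis
      using h R by (intro exI[of _ "\<lambda>x. h1 x * h2 x"]) (auto simp: q_lift_def slash_mult intro!: holomorphic_intros)
  qed
  thus ?thesis
    using assms by (auto simp: forms_def slash_mult intro!: holomorphic_intros)
qed

lemma forms_zero: "P 0 \<Longrightarrow> (\<lambda>t. 0) \<in> forms P N k"
  by (auto simp: forms_def q_lift_def slash_eq intro!: exI[of _ "\<lambda>_. 0"])

lemma forms_const:
  assumes "N > 0" "P c"
  shows "(\<lambda>t. if t \<in> upper_half_plane then c else 0) \<in> forms P N 0"
proof -
  have "(\<lambda>t. if t \<in> upper_half_plane then c else 0) holomorphic_on upper_half_plane"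
    by (rule holomorphic_transform[of "\<lambda>_. c"]) auto
  moreover have "A \<in> SL2Z" if "A \<in> principal_congruence_subgroup N" for A
    using that by (simp add: principal_congruence_subgroup_def)
  moreover have "q_lift N (slash 0 (\<lambda>t. if t \<in> upper_half_plane then c else 0) A) (\<lambda>_. c)" if "A \<in> SL2Z" for A
    using Im_moebius_pos[OF that] by (auto simp: q_lift_def slash_eq)
  ultimately show ?thesis
    using Im_moebius_pos assms(2) by (auto simp: forms_def slash_eq)
qed

lemma forms_sum:
  assumes "\<And>i. i \<in> I \<Longrightarrow> f i \<in> forms P N k" and "P 0" "\<And>x y. P x \<Longrightarrow> P y \<Longrightarrow> P (x + y)"
  shows "(\<lambda>t. \<Sum>i\<in>I. f i t) \<in> forms P N k"
  using assms(1)
proof (induction I rule: infinite_finite_induct)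
  case (insert i I)
  thus ?case by (simp add: forms_add assms(3))
qed (simp_all add: forms_zero assms(2))

section \<open>The eta power as a cusp form\<close>

definition eta_form :: "nat \<Rightarrow> complex \<Rightarrow> complex" where
  "eta_form N t = (if t \<in> upper_half_plane then dedekind_eta t ^ (24 div N) else 0)"

lemma eta_form_eq:
  assumes "N dvd 12" "Im t > 0"
  shows "eta_form N t = (dedekind_eta t ^ 2) ^ (12 div N)"
proof -
  have "24 div N = 2 * (12 div N)" using assms(1) by (auto simp: div_mult_swap)
  thus ?thesis using assms(2) by (simp add: eta_form_def power_mult)
qed

lemma eta_form_nonzero: "Im t > 0 \<Longrightarrow> eta_form N t \<noteq> 0"
  using dedekind_eta_nonzero by (simp add: eta_form_def)

lemma eta_form_holomorphic: "eta_form N holomorphic_on upper_half_plane"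
proof (rule holomorphic_transform)
  show "(\<lambda>t. dedekind_eta t ^ (24 div N)) holomorphic_on upper_half_plane"
    by (intro holomorphic_intros dedekind_eta_holomorphic)
qed (simp add: eta_form_def)

lemma of_nat_12_div: "N dvd 12 \<Longrightarrow> (of_nat (12 div N) :: complex) = 12 / of_nat N"
proof -
  assume "N dvd 12"
  then obtain m where m: "12 = N * m" by blast
  hence "(of_nat N * of_nat m :: complex) = 12"
    by (metis of_nat_mult of_nat_numeral)
  moreover have "N > 0" using m by (auto intro!: Nat.gr0I)
  ultimately show ?thesis
    by (simp add: m field_simps)
qed

text \<open>
  The twelfth root of unity by which \<open>\<eta>\<^sup>2\<close> is multiplied is raised to the power \<open>12/N\<close>, so that only \<open>N\<close>-th
  roots of unity remain.
\<close>

lemma slash_eta_form: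
  assumes "N dvd 12" "A \<in> SL2Z" "Im t > 0"
  shows "slash (12 div N) (eta_form N) A t =
    unit_exp (of_int (eta_exponent (A $ 1 $ 1) (A $ 1 $ 2) (A $ 2 $ 1) (A $ 2 $ 2)) / of_nat N) * eta_form N t"
proof -
  define w where "w = 12 div N"
  define e where "e = eta_exponent (A $ 1 $ 1) (A $ 1 $ 2) (A $ 2 $ 1) (A $ 2 $ 2)"
  have "eta_form N (moebius A t) = (unit_exp (of_int e / 12) * cocycle A t * dedekind_eta t ^ 2) ^ w"
    using dedekind_eta_squared_fractional_linear[of "A $ 1 $ 1" "A $ 2 $ 2" "A $ 1 $ 2" "A $ 2 $ 1" t]
      assms Im_moebius_pos[OF assms(2,3)]
    by (simp add: eta_form_eq moebius_def cocycle_def SL2Z_iff e_def w_def)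
  also have "\<dots> = unit_exp (of_int e / 12) ^ w * cocycle A t ^ w * eta_form N t"
    using assms by (simp add: power_mult_distrib eta_form_eq w_def)
  also have "unit_exp (of_int e / 12) ^ w = unit_exp (of_nat w * (of_int e / 12))"
    by (rule unit_exp_of_nat_mult[symmetric])
  also have "of_nat w * (of_int e / 12) = of_int e / (of_nat N :: complex)"
    using of_nat_12_div[OF assms(1)] by (simp add: w_def)
  finally show ?thesis
    using cocycle_nonzero[OF assms(2,3)] by (simp add: slash_eq w_def[symmetric] e_def)
qed

text \<open>
  This is why the multiplier is trivial on \<open>\<Gamma>(N)\<close>: modulo \<open>m\<close> the exponent may be evaluated at the identity
  matrix.
\<close>

lemma eta_exponent_cong_0:
  assumes "[a = 1] (mod m)" "[b = 0] (mod m)" "[c = 0] (mod m)" "[d = 1] (mod m)"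
  shows "[eta_exponent a b c d = 0] (mod m)"
proof -
  have "[eta_exponent a b c d = eta_exponent 1 0 0 1] (mod m)"
    unfolding eta_exponent_def
    by (intro cong_add cong_diff cong_mult cong_pow assms cong_refl)
  thus ?thesis by (simp add: eta_exponent_def)
qed

text \<open>
  What remains of the eta power, as a function of the local parameter \<open>x\<close>, after its simple zero at
  \<open>x = 0\<close> has been split off.
\<close>

definition eta_form_cofactor :: "nat \<Rightarrow> complex \<Rightarrow> complex" where
  "eta_form_cofactor N x = q_product (x ^ N) (x ^ N) ^ (24 div N)"

lemma eta_form_cofactor:
  assumes "N dvd 12"
  shows "eta_form_cofactor N holomorphic_on ball 0 1"
    and "x \<in> ball 0 1 \<Longrightarrow> eta_form_cofactor N x \<noteq> 0"
    and "Im t > 0 \<Longrightarrow> eta_form N t = unit_exp (t / of_nat N) * eta_form_cofactor N (unit_exp (t / of_nat N))"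
proof -
  have N: "N > 0" using assms by (auto intro!: Nat.gr0I)
  hence *: "norm (x ^ N) < 1" if "x \<in> ball 0 1" for x :: complex
    using that by (simp add: norm_power power_less_one_iff)
  show "eta_form_cofactor N holomorphic_on ball 0 1"
    unfolding eta_form_cofactor_def using * by (intro holomorphic_intros) auto
  show "eta_form_cofactor N x \<noteq> 0" if "x \<in> ball 0 1"
    using q_product_self_nonzero[OF *[OF that]] by (simp add: eta_form_cofactor_def)
  show "eta_form N t = unit_exp (t / of_nat N) * eta_form_cofactor N (unit_exp (t / of_nat N))" if "Im t > 0"
  proof -
    have "24 div N = 2 * (12 div N)" using assms by (auto simp: div_mult_swap)
    hence "of_nat (24 div N) * (t / 24) = t / of_nat N"
      using of_nat_12_div[OF assms] by simp
    hence 1: "unit_exp (t / 24) ^ (24 div N) = unit_exp (t / of_nat N)"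
      by (metis unit_exp_of_nat_mult)
    have 2: "unit_exp (t / of_nat N) ^ N = unit_exp t"
      using N by (simp add: unit_exp_of_nat_mult[symmetric])
    show ?thesis
      using that by (simp add: eta_form_def dedekind_eta_eq power_mult_distrib 1 2 eta_form_cofactor_def)
  qed
qed

lemma eta_form_cusp_form:
  assumes "N dvd 12"
  shows "eta_form N \<in> forms (\<lambda>x. x = 0) N (12 div N)"
  unfolding forms_def
proof (intro CollectI conjI ballI allI impI)
  have N: "N > 0" using assms by (auto intro!: Nat.gr0I)
  show "eta_form N holomorphic_on upper_half_plane" by (rule eta_form_holomorphic)
  show "eta_form N t = 0" if "t \<notin> upper_half_plane" for t using that by (simp add: eta_form_def)
  show "slash (12 div N) (eta_form N) A t = eta_form N t"
    if A: "A \<in> principal_congruence_subgroup N" and "t \<in> upper_half_plane" for A t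
  proof -
    have "[A $ i $ j = mat 1 $ i $ j] (mod int N)" for i j
      using A by (simp add: principal_congruence_subgroup_def)
    from this[of 1 1] this[of 1 2] this[of 2 1] this[of 2 2]
    have "[eta_exponent (A $ 1 $ 1) (A $ 1 $ 2) (A $ 2 $ 1) (A $ 2 $ 2) = 0] (mod int N)"
      unfolding mat_1_2 by (intro eta_exponent_cong_0)
    from unit_exp_cong[OF this N] show ?thesis
      using that slash_eta_form[OF assms, of A t] by (simp add: principal_congruence_subgroup_def)
  qed
  show "\<exists>h. q_lift N (slash (12 div N) (eta_form N) A) h \<and> h 0 = 0" if A: "A \<in> SL2Z" for A
  proof -
    define u where "u = unit_exp (of_int (eta_exponent (A $ 1 $ 1) (A $ 1 $ 2) (A $ 2 $ 1) (A $ 2 $ 2)) / of_nat N)"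
    have "q_lift N (slash (12 div N) (eta_form N) A) (\<lambda>x. u * (x * eta_form_cofactor N x))"
      unfolding q_lift_def
      by (auto simp: slash_eta_form[OF assms A] u_def eta_form_cofactor(3)[OF assms]
            intro!: holomorphic_intros eta_form_cofactor(1) assms)
    thus ?thesis by (intro exI[of _ "\<lambda>x. u * (x * eta_form_cofactor N x)"]) simp
  qed
qed

section \<open>Division of cusp forms by the eta power\<close>

text \<open>
  A transform of a cusp form vanishes at \<open>x = 0\<close>, and the eta power has only a simple zero there.
\<close>

lemma cusp_form_divide_eta_form:
  assumes "N dvd 12" "f \<in> forms (\<lambda>x. x = 0) N k" "A \<in> SL2Z"
  obtains g where "q_lift N (\<lambda>t. slash k f A t / eta_form N t) g"
proof -
  from assms(2,3) obtain h where h: "q_lift N (slash k f A) h" "h 0 = 0"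
    unfolding forms_def by blast
  define h1 where "h1 = (\<lambda>z. if z = 0 then deriv h 0 else (h z - h 0) / (z - 0))"
  have "h1 holomorphic_on ball 0 1"
    unfolding h1_def using h(1) by (intro pole_lemma_open) (auto simp: q_lift_def)
  hence "(\<lambda>x. h1 x / eta_form_cofactor N x) holomorphic_on ball 0 1"
    using eta_form_cofactor(1,2)[OF assms(1)] by (intro holomorphic_intros) auto
  moreover have "slash k f A t / eta_form N t =
      h1 (unit_exp (t / of_nat N)) / eta_form_cofactor N (unit_exp (t / of_nat N))" if "Im t > 0" for t
    using h that by (simp add: q_lift_def h1_def eta_form_cofactor(3)[OF assms(1)])
  ultimately show ?thesis
    using that unfolding q_lift_def by blast
qed

text \<open>
  At a cusp, the transform of the quotient differs only by a root of unity from the transform of \<open>f\<close> divided by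
  \<open>eta_form N\<close> itself, which is why the latter division suffices.
\<close>

lemma cusp_form_quotient_modular:
  assumes "N dvd 12" "f \<in> forms (\<lambda>x. x = 0) N (k + 12 div N)"
  shows "(\<lambda>t. f t / eta_form N t) \<in> forms (\<lambda>_. True) N k"
proof -
  define w where "w = 12 div N"
  have f: "f holomorphic_on upper_half_plane" "\<And>t. t \<notin> upper_half_plane \<Longrightarrow> f t = 0"
    "\<And>A t. A \<in> principal_congruence_subgroup N \<Longrightarrow> Im t > 0 \<Longrightarrow> slash (k + w) f A t = f t"
    using assms(2) by (auto simp: forms_def w_def)
  have eta: "\<And>A t. A \<in> principal_congruence_subgroup N \<Longrightarrow> Im t > 0 \<Longrightarrow> slash w (eta_form N) A t = eta_form N t"
    using eta_form_cusp_form[OF assms(1)] by (auto simp: forms_def w_def)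
  have sl: "slash k (\<lambda>t. f t / eta_form N t) A t = slash (k + w) f A t / slash w (eta_form N) A t"
    if "A \<in> SL2Z" "Im t > 0" for A t
    using cocycle_nonzero[OF that] by (simp add: slash_eq power_add)
  have sub: "A \<in> SL2Z" if "A \<in> principal_congruence_subgroup N" for A
    using that by (simp add: principal_congruence_subgroup_def)
  have "\<exists>h. q_lift N (slash k (\<lambda>t. f t / eta_form N t) A) h" if A: "A \<in> SL2Z" for A
  proof -
    obtain g where g: "q_lift N (\<lambda>t. slash (k + w) f A t / eta_form N t) g"
      using cusp_form_divide_eta_form[OF assms A] unfolding w_def by blast
    define u where "u = unit_exp (of_int (eta_exponent (A $ 1 $ 1) (A $ 1 $ 2) (A $ 2 $ 1) (A $ 2 $ 2)) / of_nat N)"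
    have "slash k (\<lambda>t. f t / eta_form N t) A t = inverse u * g (unit_exp (t / of_nat N))"
      if "Im t > 0" for t
    proof -
      have "slash k (\<lambda>t. f t / eta_form N t) A t = inverse u * (slash (k + w) f A t / eta_form N t)"
        unfolding sl[OF A that] w_def slash_eta_form[OF assms(1) A that] u_def
        by (simp add: field_simps)
      thus ?thesis using g that unfolding q_lift_def by metis
    qed
    hence "q_lift N (slash k (\<lambda>t. f t / eta_form N t) A) (\<lambda>x. inverse u * g x)"
      using g by (auto simp: q_lift_def intro!: holomorphic_intros)
    thus ?thesis by blast
  qed
  moreover have "(\<lambda>t. f t / eta_form N t) holomorphic_on upper_half_plane"
    using eta_form_nonzero by (intro holomorphic_intros f eta_form_holomorphic) auto
  ultimately show ?thesis
    using f(2) by (auto simp: forms_def sl sub f(3) eta)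
qed

text \<open>
  Points of height at least \<open>1/2\<close> have local parameter in a closed disc of radius \<open>exp(-\<pi>/N) < 1\<close>, which
  is compact; and only finitely many different transforms occur.
\<close>

lemma cusp_form_quotient_bounded:
  assumes "N dvd 12" "f \<in> forms (\<lambda>x. x = 0) N k"
  obtains C where "\<And>A t. A \<in> SL2Z \<Longrightarrow> Im t \<ge> 1 / 2 \<Longrightarrow> norm (slash k f A t / eta_form N t) \<le> C"
proof -
  have N: "N > 0" using assms by (auto intro!: Nat.gr0I)
  define res where "res = (\<lambda>A :: int ^ 2 ^ 2. \<lambda>(i :: 2, j :: 2). A $ i $ j mod int N)"
  \<comment> \<open>the set of values to be bounded for one matrix; it depends only on the residues of its entries\<close>
  define V where "V = (\<lambda>A. {norm (slash k f A t / eta_form N t) | t. Im t \<ge> 1 / 2})"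
  have V_cong: "V A = V B" if "A \<in> SL2Z" "B \<in> SL2Z" "res A = res B" for A B
  proof -
    have "[A $ i $ j = B $ i $ j] (mod int N)" for i j
      using fun_cong[OF that(3), of "(i, j)"] by (simp add: res_def cong_def)
    hence "slash k f A t = slash k f B t" if "Im t > 0" for t
      using assms(2) \<open>A \<in> SL2Z\<close> \<open>B \<in> SL2Z\<close> that
      by (intro slash_cong_mod[of N]) (auto simp: forms_def)
    hence "slash k f A t = slash k f B t" if "Im t \<ge> 1 / 2" for t
      using that by (smt (verit) field_sum_of_halves)
    thus ?thesis
      unfolding V_def by (intro Collect_cong iff_exI) auto
  qed
  have "bdd_above (V A)" if A: "A \<in> SL2Z" for A
  proof -
    obtain g where g: "q_lift N (\<lambda>t. slash k f A t / eta_form N t) g"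
      using cusp_form_divide_eta_form[OF assms A] by blast
    define r where "r = exp (- pi / N)"
    have r: "r < 1" using N by (simp add: r_def)
    have "g holomorphic_on ball 0 1" using g by (simp add: q_lift_def)
    hence "g holomorphic_on cball 0 r" by (rule holomorphic_on_subset) (use r in auto)
    hence "continuous_on (cball 0 r) g" by (rule holomorphic_on_imp_continuous_on)
    hence "bounded (g ` cball 0 r)"
      using compact_continuous_image compact_cball compact_imp_bounded by blast
    then obtain B where B: "\<And>x. x \<in> cball 0 r \<Longrightarrow> norm (g x) \<le> B"
      unfolding bounded_iff by blast
    have "norm (slash k f A t / eta_form N t) \<le> B" if "Im t \<ge> 1 / 2" for t
    proof -
      have "norm (unit_exp (t / of_nat N)) \<le> r"
        using that N unfolding norm_unit_exp r_def by (simp add: field_simps)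
      moreover have "Im t > 0" using that by (smt (verit) field_sum_of_halves)
      ultimately show ?thesis
        using g B[of "unit_exp (t / of_nat N)"] by (simp add: q_lift_def)
    qed
    thus ?thesis by (auto simp: V_def bdd_above_def)
  qed
  moreover have "finite (V ` SL2Z)"
  proof -
    have "res ` SL2Z \<subseteq> UNIV \<rightarrow>\<^sub>E {0..<int N}"
      using N by (auto simp: res_def)
    hence "finite (res ` SL2Z)"
      by (rule finite_subset) (auto intro: finite_PiE)
    moreover have "V ` SL2Z = (\<lambda>r. V (SOME A. A \<in> SL2Z \<and> res A = r)) ` res ` SL2Z"
    proof -
      have "V (SOME B. B \<in> SL2Z \<and> res B = res A) = V A" if "A \<in> SL2Z" for A
        using someI[of "\<lambda>B. B \<in> SL2Z \<and> res B = res A" A] that by (intro V_cong) auto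
      thus ?thesis by (simp add: image_image)
    qed
    ultimately show ?thesis by simp
  qed
  ultimately have "bdd_above (\<Union>W \<in> V ` SL2Z. W)"
    by (subst bdd_above_UN) auto
  then obtain C where "\<And>v. v \<in> (\<Union>W \<in> V ` SL2Z. W) \<Longrightarrow> v \<le> C" by (auto simp: bdd_above_def)
  hence "norm (slash k f A t / eta_form N t) \<le> C" if "A \<in> SL2Z" "Im t \<ge> 1 / 2" for A t
    using that by (auto simp: V_def)
  thus ?thesis using that by blast
qed

text \<open>
  A modular form of negative weight that is bounded at the cusps vanishes. Write \<open>t = A s\<close> with
  \<open>Im s \<ge> 1/2\<close> and \<open>j\<close> for the modulus of the automorphy factor, so that \<open>j\<^sup>2 = Im s / Im t\<close>. With
  \<open>w = 12/N\<close>, the absolute value of the quotient at \<open>t\<close> is \<open>j\<^bsup>k-w\<^esup>\<close> times a bounded quantity, where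
  \<open>k - w \<le> -1\<close>, and \<open>1/j\<close> is of order \<open>\<surd>(Im t)\<close>. In the local
  parameter this says that the quotient tends to \<open>0\<close> towards the unit circle.
\<close>

lemma cusp_form_of_small_weight_eq_0:
  assumes "N dvd 12" "f \<in> forms (\<lambda>x. x = 0) N k" "k < 12 div N"
  shows "f t = 0"
proof -
  have N: "N > 0" using assms by (auto intro!: Nat.gr0I)
  define w where "w = 12 div N"
  obtain C where C: "\<And>A t. A \<in> SL2Z \<Longrightarrow> Im t \<ge> 1 / 2 \<Longrightarrow> norm (slash k f A t / eta_form N t) \<le> C"
    using cusp_form_quotient_bounded[OF assms(1,2)] by blast
  have bound: "norm (f t / eta_form N t) \<le> C * sqrt (2 * Im t)" if t: "Im t > 0" "Im t \<le> 1 / 2" for t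
  proof -
    obtain B where B: "B \<in> SL2Z" "Im (moebius B t) \<ge> 1 / 2"
      using exists_SL2Z_Im_moebius_ge_half[OF t(1)] by blast
    obtain A where A: "A \<in> SL2Z" "A ** B = mat 1" using SL2Z_inverse[OF B(1)] by metis
    define s where "s = moebius B t"
    have s: "Im s > 0" "Im s \<ge> 1 / 2" using Im_moebius_pos[OF B(1) t(1)] B(2) by (simp_all add: s_def)
    have ts: "moebius A s = t"
      using moebius_mult[OF A(1) B(1) t(1)] by (simp add: A(2) s_def)
    define j where "j = norm (cocycle A s)"
    have j0: "j > 0" using cocycle_nonzero[OF A(1) s(1)] by (simp add: j_def)
    have "Im t = Im s / j ^ 2" using Im_moebius[OF A(1), of s] by (simp add: ts j_def)
    hence j2: "j ^ 2 = Im s / Im t" using j0 t by (simp add: field_simps)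
    also have "\<dots> \<ge> 1 / (2 * Im t)" using s t by (simp add: field_simps)
    finally have "sqrt (1 / (2 * Im t)) \<le> sqrt (j ^ 2)" by (rule real_sqrt_le_mono)
    hence jge: "1 / sqrt (2 * Im t) \<le> j" using j0 by (simp add: real_sqrt_divide)
    moreover have "1 \<le> 1 / sqrt (2 * Im t)" using t by simp
    ultimately have j1: "j \<ge> 1" by linarith
    have C0: "C \<ge> 0" using C[OF A(1) s(2)] norm_ge_zero order_trans by blast
    have "f t = slash k f A s * cocycle A s ^ k"
      using cocycle_nonzero[OF A(1) s(1)] by (simp add: slash_eq ts)
    moreover have "eta_form N t = slash w (eta_form N) A s * cocycle A s ^ w"
      using cocycle_nonzero[OF A(1) s(1)] by (simp add: slash_eq ts)
    hence "norm (eta_form N t) = norm (eta_form N s) * j ^ w"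
      unfolding w_def slash_eta_form[OF assms(1) A(1) s(1)]
      by (simp add: norm_mult norm_power norm_unit_exp j_def)
    ultimately have "norm (f t / eta_form N t) = norm (slash k f A s / eta_form N s) * (j ^ k / j ^ w)"
      by (simp add: norm_divide norm_mult norm_power j_def)
    also have "\<dots> \<le> C * (j ^ k / j ^ w)"
      using C[OF A(1) s(2)] j0 by (intro mult_right_mono) auto
    also have "j ^ k / j ^ w = 1 / j ^ (w - k)"
      using assms(3) j0 by (simp add: w_def power_diff)
    also have "C * (1 / j ^ (w - k)) \<le> C * (1 / j)"
    proof -
      have "j ^ 1 \<le> j ^ (w - k)" using assms(3) j1 by (intro power_increasing) (auto simp: w_def)
      thus ?thesis using C0 j0 by (intro mult_left_mono divide_left_mono) auto
    qed
    also have "1 / j \<le> sqrt (2 * Im t)" using jge j0 t by (simp add: field_simps)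
    finally show ?thesis using C0 by (simp add: mult_left_mono)
  qed
  have "slash k f (mat 1) = f" by (simp add: slash_eq fun_eq_iff)
  then obtain g where g: "q_lift N (\<lambda>t. f t / eta_form N t) g"
    using cusp_form_divide_eta_form[OF assms(1,2) SL2Z_mat_1] by auto
  \<comment> \<open>the circle of radius \<open>exp(-2\<pi>y/N)\<close> consists of the parameters of the points of height \<open>y\<close>\<close>
  have g0: "g x = 0" if x: "norm x < 1" for x
  proof -
    have "eventually (\<lambda>y. norm (g x) \<le> C * sqrt (2 * y)) (at_right 0)"
    proof -
      have "((\<lambda>y::real. exp (- 2 * pi * y / N)) \<longlongrightarrow> exp (- 2 * pi * 0 / N)) (at_right 0)"
        by (intro tendsto_intros) (use N in auto)
      hence "eventually (\<lambda>y::real. exp (- 2 * pi * y / N) > norm x) (at_right 0)"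
        by (rule order_tendstoD) (use x in auto)
      moreover have "eventually (\<lambda>y::real. y \<in> {0<..<1 / 2}) (at_right 0)"
        by (rule eventually_at_right_real) auto
      ultimately show ?thesis
      proof eventually_elim
        case (elim y)
        define r where "r = exp (- 2 * pi * y / N)"
        have r: "0 < r" "r < 1" "norm x < r" using elim N by (auto simp: r_def)
        show ?case
        proof (rule maximum_modulus_frontier[of g "cball 0 r"])
          show "g holomorphic_on interior (cball 0 r)" "continuous_on (closure (cball 0 r)) g"
            using g r by (auto simp: q_lift_def intro!: holomorphic_on_imp_continuous_on
              elim!: holomorphic_on_subset)
          show "norm (g z) \<le> C * sqrt (2 * y)" if "z \<in> frontier (cball 0 r)" for z
          proof -
            have z: "norm z = r" using that r by simp
            hence "z \<noteq> 0" using r by auto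
            with z obtain t where t: "Im t > 0" "unit_exp (t / of_nat N) = z"
              using unit_exp_surj_punctured_disc[OF N, of z] r by auto
            have "exp (- 2 * pi * Im (t / of_nat N)) = exp (- 2 * pi * y / N)"
              using z unfolding t(2)[symmetric] norm_unit_exp r_def .
            hence "Im t = y" using N by (simp add: field_simps)
            thus ?thesis
              using bound[of t] g t elim by (auto simp: q_lift_def)
          qed
        qed (use r in auto)
      qed
    qed
    moreover have "((\<lambda>y. C * sqrt (2 * y)) \<longlongrightarrow> C * sqrt (2 * 0)) (at_right 0)"
      by (intro tendsto_intros)
    ultimately have "norm (g x) \<le> C * sqrt (2 * 0)"
      by (intro tendsto_lowerbound) auto
    thus ?thesis by simp
  qed
  show "f t = 0"
  proof (cases "Im t > 0")
    case True
    have "norm (unit_exp (t / of_nat N)) < 1" using True N by (simp add: zero_less_divide_iff)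
    from g0[OF this] have "f t / eta_form N t = 0" using g True by (simp add: q_lift_def)
    thus ?thesis using eta_form_nonzero[OF True] by simp
  next
    case False
    thus ?thesis using assms(2) by (simp add: forms_def)
  qed
qed

section \<open>The graded ring of modular forms\<close>

lemma graded_sum_finite: "F \<in> graded_sum V \<Longrightarrow> finite {k. F k \<noteq> (\<lambda>t. 0)}"
  by (simp add: graded_sum_def)

lemma cauchy_product_in_graded_sum:
  assumes F: "F \<in> graded_sum (forms P N)" and G: "G \<in> graded_sum (forms Q N)"
    and R: "\<And>x y. P x \<Longrightarrow> Q y \<Longrightarrow> R (x * y)" "R 0" "\<And>x y. R x \<Longrightarrow> R y \<Longrightarrow> R (x + y)"
  shows "(\<lambda>k t. \<Sum>i\<le>k. F i t * G (k - i) t) \<in> graded_sum (forms R N)"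
proof -
  have "(\<lambda>t. \<Sum>i\<le>k. F i t * G (k - i) t) \<in> forms R N k" for k
  proof (rule forms_sum)
    fix i assume "i \<in> {..k}"
    thus "(\<lambda>t. F i t * G (k - i) t) \<in> forms R N k"
      using forms_mult[of "F i" P N i "G (k - i)" Q "k - i" R] F G R(1) by (simp add: graded_sum_def)
  qed (use R in auto)
  moreover have "{k. (\<lambda>t. \<Sum>i\<le>k. F i t * G (k - i) t) \<noteq> (\<lambda>t. 0)} \<subseteq>
      (\<lambda>(i, j). i + j) ` ({k. F k \<noteq> (\<lambda>t. 0)} \<times> {k. G k \<noteq> (\<lambda>t. 0)})"
  proof
    fix k assume "k \<in> {k. (\<lambda>t. \<Sum>i\<le>k. F i t * G (k - i) t) \<noteq> (\<lambda>t. 0)}"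
    then obtain t where "(\<Sum>i\<le>k. F i t * G (k - i) t) \<noteq> 0" by auto
    then obtain i where "i \<le> k" "F i t * G (k - i) t \<noteq> 0"
      by (metis (no_types, lifting) atMost_iff sum.neutral)
    hence "F i \<noteq> (\<lambda>t. 0)" "G (k - i) \<noteq> (\<lambda>t. 0)" "k = i + (k - i)" by auto
    thus "k \<in> (\<lambda>(i, j). i + j) ` ({k. F k \<noteq> (\<lambda>t. 0)} \<times> {k. G k \<noteq> (\<lambda>t. 0)})"
      by (intro image_eqI[of _ _ "(i, k - i)"]) auto
  qed
  hence "finite {k. (\<lambda>t. \<Sum>i\<le>k. F i t * G (k - i) t) \<noteq> (\<lambda>t. 0)}"
    using F G by (rule_tac finite_subset) (auto dest!: graded_sum_finite)
  ultimately show ?thesis by (simp add: graded_sum_def)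
qed

lemma modular_forms_ring_simps:
  assumes "N > 0"
  shows "carrier (modular_forms_ring N) = graded_sum (forms (\<lambda>_. True) N)"
    and "F \<otimes>\<^bsub>modular_forms_ring N\<^esub> G = (\<lambda>k t. \<Sum>i\<le>k. F i t * G (k - i) t)"
    and "F \<oplus>\<^bsub>modular_forms_ring N\<^esub> G = (\<lambda>k t. F k t + G k t)"
    and "\<zero>\<^bsub>modular_forms_ring N\<^esub> = (\<lambda>k t. 0)"
    and "\<one>\<^bsub>modular_forms_ring N\<^esub> = homogeneous 0 (\<lambda>t. 1)"
proof -
  have "modular_forms N = forms (\<lambda>_. True) N" by (intro ext modular_forms_eq assms)
  thus "carrier (modular_forms_ring N) = graded_sum (forms (\<lambda>_. True) N)"
    by (simp add: modular_forms_ring_def)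
qed (simp_all add: modular_forms_ring_def)

lemma homogeneous_in_graded_sum:
  assumes "(\<lambda>t. if t \<in> upper_half_plane then f t else 0) \<in> forms P N k" "P 0"
  shows "homogeneous k f \<in> graded_sum (forms P N)"
proof -
  have eq: "homogeneous k f j = (if j = k then (\<lambda>t. if t \<in> upper_half_plane then f t else 0) else (\<lambda>t. 0))" for j
    by (auto simp: homogeneous_def fun_eq_iff)
  have "{j. homogeneous k f j \<noteq> (\<lambda>t. 0)} \<subseteq> {k}" by (auto simp: eq)
  hence "finite {j. homogeneous k f j \<noteq> (\<lambda>t. 0)}" by (rule finite_subset) simp
  thus ?thesis
    using assms by (simp add: graded_sum_def eq forms_zero)
qed

lemma cring_modular_forms_ring:
  assumes N: "N > 0"
  shows "cring (modular_forms_ring N)"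
proof (rule cringI)
  note simps = modular_forms_ring_simps[OF N]
  have supp: "finite {k. H k \<noteq> (\<lambda>t. 0)}"
    if "{k. H k \<noteq> (\<lambda>t. 0)} \<subseteq> {k. F k \<noteq> (\<lambda>t. 0)} \<union> {k. G k \<noteq> (\<lambda>t. 0)}"
      "F \<in> graded_sum V" "G \<in> graded_sum V"
    for F G H :: "nat \<Rightarrow> complex \<Rightarrow> complex" and V
    using that by (intro finite_subset[OF that(1)]) (auto dest: graded_sum_finite)
  show "abelian_group (modular_forms_ring N)"
  proof (rule abelian_groupI, unfold simps)
    fix F G assume FG: "F \<in> graded_sum (forms (\<lambda>_. True) N)" "G \<in> graded_sum (forms (\<lambda>_. True) N)"
    have "finite {k. (\<lambda>t. F k t + G k t) \<noteq> (\<lambda>t. 0)}"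
      by (rule supp[OF _ FG]) auto
    thus "(\<lambda>k t. F k t + G k t) \<in> graded_sum (forms (\<lambda>_. True) N)"
      using FG by (simp add: graded_sum_def forms_add)
  next
    fix F assume F: "F \<in> graded_sum (forms (\<lambda>_. True) N)"
    have "(\<lambda>t. - F k t) \<in> forms (\<lambda>_. True) N k" for k
    proof -
      have "(\<lambda>t. - F k t) = (\<lambda>t. (if t \<in> upper_half_plane then - 1 else 0) * F k t)"
        using F by (auto simp: graded_sum_def forms_def fun_eq_iff)
      thus ?thesis
        using forms_mult[OF forms_const[OF N, of "\<lambda>_. True" "-1"], of "F k" "\<lambda>_. True" k "\<lambda>_. True"] F
        by (simp add: graded_sum_def)
    qed
    moreover have "finite {k. (\<lambda>t. - F k t) \<noteq> (\<lambda>t. 0)}"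
      by (rule supp[OF _ F F]) auto
    ultimately have "(\<lambda>k t. - F k t) \<in> graded_sum (forms (\<lambda>_. True) N)"
      by (simp add: graded_sum_def)
    thus "\<exists>G\<in>graded_sum (forms (\<lambda>_. True) N). (\<lambda>k t. G k t + F k t) = (\<lambda>k t. 0)"
      by (rule rev_bexI) simp
  qed (auto simp: graded_sum_def forms_zero algebra_simps)
  show "comm_monoid (modular_forms_ring N)"
  proof (rule comm_monoidI, unfold simps)
    fix F G assume FG: "F \<in> graded_sum (forms (\<lambda>_. True) N)" "G \<in> graded_sum (forms (\<lambda>_. True) N)"
    show "(\<lambda>k t. \<Sum>i\<le>k. F i t * G (k - i) t) \<in> graded_sum (forms (\<lambda>_. True) N)"
      by (rule cauchy_product_in_graded_sum[OF FG]) auto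
  next
    show "homogeneous 0 (\<lambda>t. 1) \<in> graded_sum (forms (\<lambda>_. True) N)"
      by (intro homogeneous_in_graded_sum forms_const N) auto
  next
    fix F G H :: "nat \<Rightarrow> complex \<Rightarrow> complex"
    \<comment> \<open>pointwise the multiplication is that of formal power series with the components as coefficients,
        which supplies associativity and commutativity\<close>
    have mult: "fps_nth (Abs_fps (\<lambda>i. F i t) * Abs_fps (\<lambda>i. G i t)) k = (\<Sum>i\<le>k. F i t * G (k - i) t)"
      for k t and F G :: "nat \<Rightarrow> complex \<Rightarrow> complex"
      by (simp add: fps_mult_nth atLeast0AtMost)
    have mult': "Abs_fps (\<lambda>k. \<Sum>i\<le>k. F i t * G (k - i) t) = Abs_fps (\<lambda>i. F i t) * Abs_fps (\<lambda>i. G i t)"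
      for t and F G :: "nat \<Rightarrow> complex \<Rightarrow> complex"
      by (simp add: fps_eq_iff mult)
    show "(\<lambda>k t. \<Sum>i\<le>k. (\<Sum>j\<le>i. F j t * G (i - j) t) * H (k - i) t) =
        (\<lambda>k t. \<Sum>i\<le>k. F i t * (\<Sum>j\<le>k - i. G j t * H (k - i - j) t))"
      using mult[of "\<lambda>k t. \<Sum>i\<le>k. F i t * G (k - i) t" _ H]
        mult[of F _ "\<lambda>k t. \<Sum>i\<le>k. G i t * H (k - i) t"]
      by (simp add: mult' mult.assoc fun_eq_iff)
    show "(\<lambda>k t. \<Sum>i\<le>k. F i t * G (k - i) t) = (\<lambda>k t. \<Sum>i\<le>k. G i t * F (k - i) t)"
      by (intro ext) (metis mult mult.commute)
  next
    fix F assume F: "F \<in> graded_sum (forms (\<lambda>_. True) N)"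
    have "(\<Sum>i\<le>k. homogeneous 0 (\<lambda>t. 1) i t * F (k - i) t) = F k t" for k t
    proof -
      have "(\<Sum>i\<le>k. homogeneous 0 (\<lambda>t. 1) i t * F (k - i) t) =
          (\<Sum>i\<le>k. if i = 0 then (if t \<in> upper_half_plane then F k t else 0) else 0)"
        by (intro sum.cong) (auto simp: homogeneous_def)
      also have "\<dots> = (if t \<in> upper_half_plane then F k t else 0)" by simp
      also have "\<dots> = F k t" using F by (auto simp: graded_sum_def forms_def)
      finally show ?thesis .
    qed
    thus "(\<lambda>k t. \<Sum>i\<le>k. homogeneous 0 (\<lambda>t. 1) i t * F (k - i) t) = F" by simp
  qed
qed (simp_all add: modular_forms_ring_simps[OF N] sum.distrib distrib_right)

section \<open>The ideal of cusp forms\<close>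

lemma eta_power_eq:
  "eta_power N j = (if j = 12 div N then eta_form N else (\<lambda>t. 0))"
  by (auto simp: eta_power_def homogeneous_def eta_form_def fun_eq_iff)

lemma mult_eta_power:
  "(\<Sum>i\<le>k. G i t * eta_power N (k - i) t) = (if 12 div N \<le> k then G (k - 12 div N) t * eta_form N t else 0)"
proof -
  have "(\<Sum>i\<le>k. G i t * eta_power N (k - i) t) =
      (\<Sum>i\<le>k. if i = k - 12 div N then (if 12 div N \<le> k then G i t * eta_form N t else 0) else 0)"
    by (intro sum.cong) (auto simp: eta_power_eq)
  thus ?thesis by simp
qed

theorem theorem23:
  fixes N :: nat
  assumes "N \<in> {1, 2, 3, 4, 6, 12}"
  shows "principalideal (cusp_forms_ideal N) (modular_forms_ring N) \<and>
    eta_power N \<in> carrier (modular_forms_ring N) \<and>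
    cusp_forms_ideal N = PIdl\<^bsub>modular_forms_ring N\<^esub> (eta_power N)"
proof -
  define w where "w = 12 div N"
  have N: "N > 0" "N dvd 12" using assms by auto
  note simps = modular_forms_ring_simps[OF N(1)]
  have cusp: "cusp_forms_ideal N = graded_sum (forms (\<lambda>x. x = 0) N)"
    unfolding cusp_forms_ideal_def using cusp_forms_eq[OF N(1)] by metis
  have eta_cusp: "eta_power N \<in> graded_sum (forms (\<lambda>x. x = 0) N)"
    unfolding eta_power_def using eta_form_cusp_form[OF N(2)]
    by (intro homogeneous_in_graded_sum) (simp_all add: eta_form_def[abs_def])
  have "graded_sum (forms (\<lambda>x. x = 0) N) \<subseteq> graded_sum (forms (\<lambda>_. True) N)"
    using forms_mono[of "\<lambda>x. x = 0" "\<lambda>_. True" N] by (auto simp: graded_sum_def)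
  with eta_cusp have eta: "eta_power N \<in> carrier (modular_forms_ring N)"
    unfolding simps by blast
  have "PIdl\<^bsub>modular_forms_ring N\<^esub> (eta_power N) = cusp_forms_ideal N"
  proof
    show "PIdl\<^bsub>modular_forms_ring N\<^esub> (eta_power N) \<subseteq> cusp_forms_ideal N"
    proof
      fix F assume "F \<in> PIdl\<^bsub>modular_forms_ring N\<^esub> (eta_power N)"
      then obtain G where "G \<in> graded_sum (forms (\<lambda>_. True) N)"
        "F = (\<lambda>k t. \<Sum>i\<le>k. G i t * eta_power N (k - i) t)"
        unfolding cgenideal_def simps by blast
      thus "F \<in> cusp_forms_ideal N"
        unfolding cusp using cauchy_product_in_graded_sum[OF _ eta_cusp, of G "\<lambda>_. True" "\<lambda>x. x = 0"] by simp
    qed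
    show "cusp_forms_ideal N \<subseteq> PIdl\<^bsub>modular_forms_ring N\<^esub> (eta_power N)"
    proof
      fix F assume "F \<in> cusp_forms_ideal N"
      hence F: "F k \<in> forms (\<lambda>x. x = 0) N k" "finite {k. F k \<noteq> (\<lambda>t. 0)}" for k
        unfolding cusp by (auto simp: graded_sum_def)
      define G where "G = (\<lambda>k t. F (k + w) t / eta_form N t)"
      have "G k \<in> forms (\<lambda>_. True) N k" for k
        unfolding G_def w_def by (rule cusp_form_quotient_modular[OF N(2) F(1)])
      moreover have "{k. G k \<noteq> (\<lambda>t. 0)} \<subseteq> (\<lambda>k. k - w) ` {k. F k \<noteq> (\<lambda>t. 0)}"
      proof
        fix k assume "k \<in> {k. G k \<noteq> (\<lambda>t. 0)}"
        hence "F (k + w) \<noteq> (\<lambda>t. 0)" by (auto simp: G_def)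
        thus "k \<in> (\<lambda>k. k - w) ` {k. F k \<noteq> (\<lambda>t. 0)}" by (intro image_eqI[of _ _ "k + w"]) auto
      qed
      hence "finite {k. G k \<noteq> (\<lambda>t. 0)}" by (rule finite_subset) (use F(2) in simp)
      ultimately have "G \<in> graded_sum (forms (\<lambda>_. True) N)" by (simp add: graded_sum_def)
      moreover have "F k t = (\<Sum>i\<le>k. G i t * eta_power N (k - i) t)" for k t
      proof (cases "w \<le> k")
        case True
        show ?thesis
        proof (cases "Im t > 0")
          case t: True
          thus ?thesis using True eta_form_nonzero[OF t, of N]
            unfolding mult_eta_power by (simp add: G_def w_def[symmetric])
        next
          case False
          hence "F k t = 0" "eta_form N t = 0"
            using F(1)[of k] by (simp_all add: forms_def eta_form_def)
          thus ?thesis by (simp add: mult_eta_power)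
        qed
      next
        case False
        thus ?thesis
          using cusp_form_of_small_weight_eq_0[OF N(2) F(1)[of k]]
          by (simp add: mult_eta_power w_def)
      qed
      ultimately show "F \<in> PIdl\<^bsub>modular_forms_ring N\<^esub> (eta_power N)"
        unfolding cgenideal_def simps by blast
    qed
  qed
  thus ?thesis
    using eta cring.cgenideal_is_principalideal[OF cring_modular_forms_ring[OF N(1)] eta] by simp
qed

end
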